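(* Let $n\ge 1$ and let $\alpha\in \mathsf{Comp}_n=\mathbb{Z}_{\ge 0}^n$ be a weak composition of length $n$. The key polynomial $\kappa_\alpha$ is multiplicity-free if and only if $\alpha\in\overline{\mathsf{KM}}_n$, i.e. if and only if $\alpha$ avoids each of the composition patterns $$(0,1,2),\quad (0,0,2,2),\quad (0,0,2,1),\quad (1,0,3,2),\quad (1,0,2,2).$$
   Context: Demazure operators: on $\mathbb{Z}[x_1,\ldots,x_n]$, for $1\le j\le n-1$, $\pi_j(f)=\dfrac{x_j f - x_{j+1}\, s_j f}{x_j-x_{j+1}}$, where $s_jf$ is $f$ with the variables $x_j$ and $x_{j+1}$ exchanged. Key polynomials: for a weak composition $\alpha=(\alpha_1,\ldots,\alpha_n)\in\mathbb{Z}_{\ge0}^n$, if $\alpha$ is weakly decreasing then $\kappa_\alpha=x^\alpha:=x_1^{\alpha_1}\cdots x_n^{\alpha_n}$. Otherwise $\kappa_\alpha=\pi_j(\kappa_{\widehat\alpha})$, where $j$ is such that $\alpha_{j+1}>\alpha_j$ and $\widehat\alpha=(\alpha_1,\ldots,\alpha_{j+1},\alpha_j,\ldots,\alpha_n)$ is $\alpha$ with the entries in positions $j$ and $j+1$ exchanged. (This is well defined.) Multiplicity-free: writing $\kappa_\alpha=\sum_{\gamma\in\mathsf{Comp}_n}c_\gamma x^\gamma$, the polynomial $\kappa_\alpha$ is multiplicity-free if $c_\gamma\in\{0,1\}$ for all $\gamma\in\mathsf{Comp}_n$. Composition patterns: for weak compositions $\alpha=(\alpha_1,\ldots,\alpha_\ell)$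 and $\beta=(\beta_1,\ldots,\beta_k)$, $\alpha$ contains the composition pattern $\beta$ if there exist integers $1\le j_1<j_2<\cdots<j_k\le \ell$ such that, for all $s,t\in\{1,\ldots,k\}$: (i) $\alpha_{j_s}\le\alpha_{j_t}$ if and only if $\beta_s\le\beta_t$; and (ii) $|\alpha_{j_s}-\alpha_{j_t}|\ge|\beta_s-\beta_t|$. If $\alpha$ does not contain $\beta$, then $\alpha$ avoids $\beta$. $\overline{\mathsf{KM}}_n$ is the set of $\alpha\in\mathsf{Comp}_n$ avoiding all five patterns listed in the claim. *)

theory Defs
  imports "HOL-Library.Poly_Mapping" "HOL-Combinatorics.Transposition"
begin

section \<open>Polynomials\<close>

text \<open>
  Polynomials with integer coefficients are finitely supported maps from exponents to
  coefficients, and an exponent is a finitely supported map from variable indices to \<^typ>\<open>nat\<close>.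
  Indices start at 0, for variables as for the entries of lists: the polynomial ring in the
  variables \<open>x_1, ..., x_n\<close> is the subring on the variables \<open>var 0, ..., var (n - 1)\<close>, and the
  Demazure operator \<open>\<pi>_j\<close> is \<open>demazure (j - 1)\<close>.
\<close>

type_synonym exponent = "nat \<Rightarrow>\<^sub>0 nat"
type_synonym polynomial = "exponent \<Rightarrow>\<^sub>0 int"

definition var :: "nat \<Rightarrow> polynomial" where
  "var i = Poly_Mapping.single (Poly_Mapping.single i 1) 1"

definition monomial :: "nat list \<Rightarrow> polynomial" where
  "monomial \<alpha> = (\<Prod>i<length \<alpha>. var i ^ (\<alpha> ! i))"

text \<open>\<open>Poly_Mapping.nth \<gamma>\<close> is the exponent of \<open>monomial \<gamma>\<close>, see \<open>monomial_eq_single\<close> below.\<close>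

definition coefficient :: "polynomial \<Rightarrow> nat list \<Rightarrow> int" where
  "coefficient f \<gamma> = Poly_Mapping.lookup f (Poly_Mapping.nth \<gamma>)"

text \<open>
  \<open>map_key\<close> precomposes with its argument; as the transposition is an involution, this is the
  substitution exchanging the two variables, see \<open>swap_vars_var\<close> and \<open>swap_vars_mult\<close> below.
\<close>

definition swap_vars :: "nat \<Rightarrow> polynomial \<Rightarrow> polynomial" where
  "swap_vars j f = Poly_Mapping.map_key (Poly_Mapping.map_key (transpose j (Suc j))) f"


section \<open>Demazure operators and key polynomials\<close>

text \<open>The quotient exists and is unique, see \<open>demazure_unique\<close> and \<open>demazure_eq\<close> below.\<close>

definition demazure :: "nat \<Rightarrow> polynomial \<Rightarrow> polynomial" where
  "demazure j f =
     (THE g. (var j - var (Suc j)) * g = var j * f - var (Suc j) * swap_vars j f)"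

definition swap_entries :: "nat \<Rightarrow> nat list \<Rightarrow> nat list" where
  "swap_entries j \<alpha> = \<alpha>[j := \<alpha> ! Suc j, Suc j := \<alpha> ! j]"

definition ascent :: "nat list \<Rightarrow> nat \<Rightarrow> bool" where
  "ascent \<alpha> j \<longleftrightarrow> Suc j < length \<alpha> \<and> \<alpha> ! j < \<alpha> ! Suc j"

lemma length_swap_entries [simp]: "length (swap_entries j \<alpha>) = length \<alpha>"
  by (simp add: swap_entries_def)

lemma weakly_decreasing_iff_no_ascent: "sorted_wrt (\<ge>) \<alpha> \<longleftrightarrow> (\<nexists>j. ascent \<alpha> j)"
proof -
  have "sorted_wrt (\<ge>) \<alpha> \<longleftrightarrow> (\<forall>j. Suc j < length \<alpha> \<longrightarrow> \<alpha> ! j \<ge> \<alpha> ! Suc j)"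
    by (rule sorted_wrt_iff_nth_Suc_transp) simp
  also have "\<dots> \<longleftrightarrow> (\<nexists>j. ascent \<alpha> j)"
    unfolding ascent_def by (meson not_less)
  finally show ?thesis .
qed

lemma ascent_decreases:
  assumes "ascent \<alpha> j"
  shows "(\<Sum>i<length \<alpha>. i * swap_entries j \<alpha> ! i) < (\<Sum>i<length \<alpha>. i * \<alpha> ! i)"
proof -
  let ?R = "{..<length \<alpha>} - {j, Suc j}"
  have j: "Suc j < length \<alpha>" "\<alpha> ! j < \<alpha> ! Suc j"
    using assms by (auto simp: ascent_def)
  have split: "(\<Sum>i<length \<alpha>. g i) = g j + g (Suc j) + sum g ?R" for g :: "nat \<Rightarrow> nat"
  proof -
    have "{..<length \<alpha>} = insert j (insert (Suc j) ?R)"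
      using j by auto
    then have "sum g {..<length \<alpha>} = sum g (insert j (insert (Suc j) ?R))"
      by (rule arg_cong)
    then show ?thesis
      by simp
  qed
  have rest: "(\<Sum>i\<in>?R. i * swap_entries j \<alpha> ! i) = (\<Sum>i\<in>?R. i * \<alpha> ! i)"
    by (rule sum.cong) (auto simp: swap_entries_def nth_list_update)
  show ?thesis
    unfolding split rest using j by (simp add: swap_entries_def nth_list_update)
qed

text \<open>
  The recursion may use any ascent of \<open>\<alpha>\<close>. The definition picks one; \<open>key_poly_ascent\<close>
  below shows that the choice is immaterial.
\<close>

function key_poly :: "nat list \<Rightarrow> polynomial" where
  "key_poly \<alpha> =
     (if sorted_wrt (\<ge>) \<alpha> then monomial \<alpha>
      else let j = (SOME j. ascent \<alpha> j) in demazure j (key_poly (swap_entries j \<alpha>)))"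
  by auto
termination
proof (relation "measure (\<lambda>\<alpha>. \<Sum>i<length \<alpha>. i * \<alpha> ! i)")
  fix \<alpha> :: "nat list" and j
  assume "\<not> sorted_wrt (\<ge>) \<alpha>" and "j = (SOME j. ascent \<alpha> j)"
  then have "ascent \<alpha> j"
    by (auto simp: weakly_decreasing_iff_no_ascent intro: someI)
  then show "(swap_entries j \<alpha>, \<alpha>) \<in> measure (\<lambda>\<alpha>. \<Sum>i<length \<alpha>. i * \<alpha> ! i)"
    using ascent_decreases by simp
qed simp

declare key_poly.simps [simp del]

definition multiplicity_free :: "nat \<Rightarrow> polynomial \<Rightarrow> bool" where
  "multiplicity_free n f \<longleftrightarrow> (\<forall>\<gamma>. length \<gamma> = n \<longrightarrow> coefficient f \<gamma> \<in> {0, 1})"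


section \<open>Composition patterns\<close>

definition contains_pattern :: "nat list \<Rightarrow> nat list \<Rightarrow> bool" where
  "contains_pattern \<alpha> \<beta> \<longleftrightarrow>
     (\<exists>p :: nat \<Rightarrow> nat. strict_mono_on {..<length \<beta>} p \<and> (\<forall>s<length \<beta>. p s < length \<alpha>) \<and>
        (\<forall>s<length \<beta>. \<forall>t<length \<beta>.
           (\<alpha> ! p s \<le> \<alpha> ! p t \<longleftrightarrow> \<beta> ! s \<le> \<beta> ! t) \<and>
           \<bar>int (\<alpha> ! p s) - int (\<alpha> ! p t)\<bar> \<ge> \<bar>int (\<beta> ! s) - int (\<beta> ! t)\<bar>))"

abbreviation avoids_pattern :: "nat list \<Rightarrow> nat list \<Rightarrow> bool" where
  "avoids_pattern \<alpha> \<beta> \<equiv> \<not> contains_pattern \<alpha> \<beta>"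

definition KM :: "nat \<Rightarrow> nat list set" where
  "KM n = {\<alpha>. length \<alpha> = n \<and>
     (\<forall>\<beta>\<in>{[0,1,2], [0,0,2,2], [0,0,2,1], [1,0,3,2], [1,0,2,2]}. avoids_pattern \<alpha> \<beta>)}"


section \<open>Well-definedness\<close>

lemma var_power: "var i ^ k = Poly_Mapping.single (Poly_Mapping.single i k) 1"
proof (induction k)
  case (Suc k)
  have "Poly_Mapping.single i (1::nat) + Poly_Mapping.single i k = Poly_Mapping.single i (Suc k)"
    by (simp flip: single_add)
  with Suc show ?case
    by (simp add: var_def mult_single)
qed simp

lemma monomial_eq_single: "monomial \<alpha> = Poly_Mapping.single (Poly_Mapping.nth \<alpha>) 1"
proof -
  have "(\<Prod>i\<in>I. var i ^ (\<alpha> ! i)) =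
      Poly_Mapping.single (\<Sum>i\<in>I. Poly_Mapping.single i (\<alpha> ! i)) 1" if "finite I" for I
    using that by induction (simp_all add: var_power mult_single)
  moreover have "(\<Sum>i<length \<alpha>. Poly_Mapping.single i (\<alpha> ! i)) = Poly_Mapping.nth \<alpha>"
    by (rule poly_mapping_eqI)
      (simp add: lookup_sum lookup_single nth_default_def when_def)
  ultimately show ?thesis
    by (simp add: monomial_def)
qed

lemma coefficient_monomial:
  assumes "length \<gamma> = length \<alpha>"
  shows "coefficient (monomial \<alpha>) \<gamma> = (if \<gamma> = \<alpha> then 1 else 0)"
proof -
  have "\<gamma> = \<alpha>" if "Poly_Mapping.nth \<gamma> = Poly_Mapping.nth \<alpha>"
  proof (rule nth_equalityI)
    fix i assume "i < length \<gamma>"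
    moreover have "nth_default 0 \<gamma> i = nth_default 0 \<alpha> i"
      using that by (metis lookup_nth)
    ultimately show "\<gamma> ! i = \<alpha> ! i"
      using assms by (simp add: nth_default_def)
  qed (fact assms)
  then show ?thesis
    by (auto simp: coefficient_def monomial_eq_single lookup_single when_def)
qed

definition swap_exponent :: "nat \<Rightarrow> exponent \<Rightarrow> exponent" where
  "swap_exponent j = Poly_Mapping.map_key (transpose j (Suc j))"

lemma lookup_swap_exponent:
  "Poly_Mapping.lookup (swap_exponent j m) i = Poly_Mapping.lookup m (transpose j (Suc j) i)"
  by (simp add: swap_exponent_def map_key.rep_eq)

lemma swap_exponent_involutory [simp]: "swap_exponent j (swap_exponent j m) = m"
  by (rule poly_mapping_eqI) (simp add: lookup_swap_exponent)

lemma inj_swap_exponent: "inj (swap_exponent j)"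
  by (metis injI swap_exponent_involutory)

lemma swap_exponent_add: "swap_exponent j (m + m') = swap_exponent j m + swap_exponent j m'"
  by (rule poly_mapping_eqI) (simp add: lookup_swap_exponent lookup_add)

lemma swap_exponent_single:
  "swap_exponent j (Poly_Mapping.single i k) = Poly_Mapping.single (transpose j (Suc j) i) k"
  by (rule poly_mapping_eqI)
    (auto simp: lookup_swap_exponent lookup_single when_def transpose_def)

lemma lookup_swap_vars:
  "Poly_Mapping.lookup (swap_vars j f) m = Poly_Mapping.lookup f (swap_exponent j m)"
  by (simp add: swap_vars_def map_key.rep_eq inj_swap_exponent flip: swap_exponent_def)

lemma swap_vars_single:
  "swap_vars j (Poly_Mapping.single m c) = Poly_Mapping.single (swap_exponent j m) c"
proof (rule poly_mapping_eqI)
  fix m'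
  have "swap_exponent j m' = m \<longleftrightarrow> m' = swap_exponent j m"
    by (metis swap_exponent_involutory)
  then show "Poly_Mapping.lookup (swap_vars j (Poly_Mapping.single m c)) m' =
      Poly_Mapping.lookup (Poly_Mapping.single (swap_exponent j m) c) m'"
    by (auto simp: lookup_swap_vars lookup_single when_def)
qed

lemma swap_vars_0 [simp]: "swap_vars j 0 = 0"
  by (rule poly_mapping_eqI) (simp add: lookup_swap_vars)

lemma swap_vars_add: "swap_vars j (f + g) = swap_vars j f + swap_vars j g"
  by (rule poly_mapping_eqI) (simp add: lookup_swap_vars lookup_add)

lemma swap_vars_diff: "swap_vars j (f - g) = swap_vars j f - swap_vars j g"
  by (rule poly_mapping_eqI) (simp add: lookup_swap_vars lookup_minus)

lemma swap_vars_var: "swap_vars j (var i) = var (transpose j (Suc j) i)"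
  by (simp add: var_def swap_vars_single swap_exponent_single)

lemma swap_vars_involutory: "swap_vars j (swap_vars j f) = f"
  by (rule poly_mapping_eqI) (simp add: lookup_swap_vars)

lemma poly_mapping_single_induct [case_names zero single_add]:
  fixes f :: "'a \<Rightarrow>\<^sub>0 'b::comm_monoid_add"
  assumes "P 0" and "\<And>m c f. P f \<Longrightarrow> P (Poly_Mapping.single m c + f)"
  shows "P f"
proof (induction f rule: update_induct)
  case const
  then show ?case
    using assms(1) by simp
next
  case (update f m c)
  then have "Poly_Mapping.update m c f = Poly_Mapping.single m c + f"
    by (intro poly_mapping_eqI)
      (auto simp: lookup_update lookup_add lookup_single when_def in_keys_iff)
  then show ?case
    using assms(2) update by simp
qed

lemma swap_vars_mult: "swap_vars j (f * g) = swap_vars j f * swap_vars j g"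
proof (induction f rule: poly_mapping_single_induct)
  case (single_add m c f)
  have "swap_vars j (Poly_Mapping.single m c * g) =
      swap_vars j (Poly_Mapping.single m c) * swap_vars j g"
    by (induction g rule: poly_mapping_single_induct)
      (simp_all add: distrib_left swap_vars_add swap_vars_single mult_single swap_exponent_add)
  with single_add show ?case
    by (simp add: distrib_right swap_vars_add)
qed simp

lemma swap_vars_commute:
  assumes "Suc i < j"
  shows "swap_vars i (swap_vars j f) = swap_vars j (swap_vars i f)"
proof (rule poly_mapping_eqI)
  fix m
  have "swap_exponent j (swap_exponent i m) = swap_exponent i (swap_exponent j m)"
    using assms by (intro poly_mapping_eqI) (auto simp: lookup_swap_exponent transpose_def)
  then show "Poly_Mapping.lookup (swap_vars i (swap_vars j f)) m =
      Poly_Mapping.lookup (swap_vars j (swap_vars i f)) m"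
    by (simp add: lookup_swap_vars)
qed

lemma swap_vars_braid:
  "swap_vars i (swap_vars (Suc i) (swap_vars i f)) =
   swap_vars (Suc i) (swap_vars i (swap_vars (Suc i) f))"
proof (rule poly_mapping_eqI)
  fix m
  have "swap_exponent i (swap_exponent (Suc i) (swap_exponent i m)) =
      swap_exponent (Suc i) (swap_exponent i (swap_exponent (Suc i) m))"
    by (intro poly_mapping_eqI) (auto simp: lookup_swap_exponent transpose_def)
  then show "Poly_Mapping.lookup (swap_vars i (swap_vars (Suc i) (swap_vars i f))) m =
      Poly_Mapping.lookup (swap_vars (Suc i) (swap_vars i (swap_vars (Suc i) f))) m"
    by (simp add: lookup_swap_vars)
qed

lemma var_eq_iff [simp]: "var i = var j \<longleftrightarrow> i = j"
proof
  assume "var i = var j"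
  then have "Poly_Mapping.lookup (var i) (Poly_Mapping.single j 1) = 1"
    by (simp add: var_def)
  then have "Poly_Mapping.single i (1::nat) = Poly_Mapping.single j 1"
    by (auto simp: var_def lookup_single when_def split: if_splits)
  then have "Poly_Mapping.lookup (Poly_Mapping.single i (1::nat)) j = 1"
    by simp
  then show "i = j"
    by (auto simp: lookup_single when_def split: if_splits)
qed simp

lemma dvd_swap_vars_diff: "var j - var (Suc j) dvd f - swap_vars j f"
proof (induction f rule: poly_mapping_single_induct)
  case (single_add m c f)
  let ?d = "var j - var (Suc j)"
  have mult: "?d dvd g * h - swap_vars j (g * h)"
    if "?d dvd g - swap_vars j g" "?d dvd h - swap_vars j h" for g h
  proof -
    have "g * h - swap_vars j (g * h) =
        g * (h - swap_vars j h) + (g - swap_vars j g) * swap_vars j h"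
      by (simp add: swap_vars_mult algebra_simps)
    then show ?thesis
      using that by simp
  qed
  have const: "swap_vars j (Poly_Mapping.single 0 c) = Poly_Mapping.single 0 c" for c
    by (simp add: swap_vars_single swap_exponent_def)
  have var: "?d dvd var i - swap_vars j (var i)" for i
  proof -
    have "?d dvd var (Suc j) - var j"
      by (metis dvd_refl dvd_minus_iff minus_diff_eq)
    then show ?thesis
      by (auto simp: swap_vars_var transpose_def)
  qed
  have pow: "?d dvd var i ^ k - swap_vars j (var i ^ k)" for i k
  proof (induction k)
    case 0
    then show ?case
      using const[of 1] by simp
  next
    case (Suc k)
    then show ?case
      using mult[OF var Suc] by simp
  qed
  have "?d dvd Poly_Mapping.single m c - swap_vars j (Poly_Mapping.single m c)" for m c
  proof (induction m arbitrary: c rule: poly_mapping_single_induct)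
    case zero
    then show ?case
      by (simp add: const)
  next
    case (single_add i k m)
    have "Poly_Mapping.single (Poly_Mapping.single i k + m) c =
        var i ^ k * Poly_Mapping.single m c"
      by (simp add: var_power mult_single)
    then show ?case
      using mult[OF pow single_add] by simp
  qed
  from dvd_add[OF this single_add.IH] show ?case
    by (simp add: swap_vars_add algebra_simps)
qed simp

lemma demazure_unique:
  "\<exists>!g. (var j - var (Suc j)) * g = var j * f - var (Suc j) * swap_vars j f"
proof (rule ex_ex1I)
  obtain h where h: "f - swap_vars j f = (var j - var (Suc j)) * h"
    using dvd_swap_vars_diff by (metis dvdE)
  have "(var j - var (Suc j)) * (f + var (Suc j) * h) =
      (var j - var (Suc j)) * f + var (Suc j) * (f - swap_vars j f)"
    unfolding h by (simp add: algebra_simps)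
  also have "\<dots> = var j * f - var (Suc j) * swap_vars j f"
    by (simp add: algebra_simps)
  finally show "\<exists>g. (var j - var (Suc j)) * g = var j * f - var (Suc j) * swap_vars j f" ..
next
  fix g h
  assume "(var j - var (Suc j)) * g = var j * f - var (Suc j) * swap_vars j f"
    and "(var j - var (Suc j)) * h = var j * f - var (Suc j) * swap_vars j f"
  then have "(var j - var (Suc j)) * g = (var j - var (Suc j)) * h"
    by simp
  then show "g = h"
    by simp
qed

lemma demazure_eq:
  "(var j - var (Suc j)) * demazure j f = var j * f - var (Suc j) * swap_vars j f"
  unfolding demazure_def by (rule theI'[OF demazure_unique])

lemma swap_vars_demazure_eq:
  "(swap_vars i (var j) - swap_vars i (var (Suc j))) * swap_vars i (demazure j f) =
   swap_vars i (var j) * swap_vars i f - swap_vars i (var (Suc j)) * swap_vars i (swap_vars j f)"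
  using arg_cong[OF demazure_eq, of "swap_vars i" j f]
  by (simp add: swap_vars_mult swap_vars_diff)

lemma demazure_commute:
  assumes "Suc i < j"
  shows "demazure i (demazure j f) = demazure j (demazure i f)"
proof -
  let ?a = "var i" and ?b = "var (Suc i)" and ?c = "var j" and ?d = "var (Suc j)"
  have i: "(?c - ?d) * swap_vars i (demazure j f) =
      ?c * swap_vars i f - ?d * swap_vars i (swap_vars j f)"
    using swap_vars_demazure_eq[of i j f] assms by (simp add: swap_vars_var transpose_def)
  have j: "(?a - ?b) * swap_vars j (demazure i f) =
      ?a * swap_vars j f - ?b * swap_vars i (swap_vars j f)"
    using swap_vars_demazure_eq[of j i f] assms
    by (simp add: swap_vars_var transpose_def swap_vars_commute[OF assms])
  have "(?a - ?b) * (?c - ?d) * demazure i (demazure j f) =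
      (?c - ?d) * ((?a - ?b) * demazure i (demazure j f))"
    by (simp only: mult_ac)
  also have "\<dots> = ?a * ((?c - ?d) * demazure j f) - ?b * ((?c - ?d) * swap_vars i (demazure j f))"
    unfolding demazure_eq[of i] by (simp add: algebra_simps)
  also have "\<dots> = ?c * (?a * f - ?b * swap_vars i f) -
      ?d * (?a * swap_vars j f - ?b * swap_vars i (swap_vars j f))"
    unfolding i demazure_eq by (simp add: algebra_simps)
  also have "\<dots> = ?c * ((?a - ?b) * demazure i f) - ?d * ((?a - ?b) * swap_vars j (demazure i f))"
    unfolding j demazure_eq ..
  also have "\<dots> = (?a - ?b) * ((?c - ?d) * demazure j (demazure i f))"
    unfolding demazure_eq[of j] by (simp add: algebra_simps)
  finally have "(?a - ?b) * (?c - ?d) * demazure i (demazure j f) =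
      (?a - ?b) * (?c - ?d) * demazure j (demazure i f)"
    by (simp only: mult.assoc)
  then show ?thesis
    using assms by simp
qed

lemma swap_vars_demazure [simp]: "swap_vars j (demazure j f) = demazure j f"
proof -
  have "(var (Suc j) - var j) * swap_vars j (demazure j f) =
      var (Suc j) * swap_vars j f - var j * f"
    using swap_vars_demazure_eq[of j j f]
    by (simp add: swap_vars_var swap_vars_involutory)
  then have "(var j - var (Suc j)) * swap_vars j (demazure j f) =
      (var j - var (Suc j)) * demazure j f"
    unfolding demazure_eq by (simp add: algebra_simps)
  then show ?thesis
    by simp
qed

lemma demazure_braid:
  "demazure i (demazure (Suc i) (demazure i f)) =
   demazure (Suc i) (demazure i (demazure (Suc i) f))"
proof -
  let ?x = "var i" and ?y = "var (Suc i)" and ?z = "var (Suc (Suc i))"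
  define s t p q where "s = swap_vars i" and "t = swap_vars (Suc i)"
    and "p = demazure i" and "q = demazure (Suc i)"
  have p: "(?x - ?y) * p g = ?x * g - ?y * s g" for g
    by (simp add: p_def s_def demazure_eq)
  have q: "(?y - ?z) * q g = ?y * g - ?z * t g" for g
    by (simp add: q_def t_def demazure_eq)
  have var [simp]: "s ?x = ?y" "s ?y = ?x" "s ?z = ?z" "t ?x = ?x" "t ?y = ?z" "t ?z = ?y"
    by (simp_all add: s_def t_def swap_vars_var transpose_def)
  have hom: "s (g - h) = s g - s h" "s (g * h) = s g * s h"
    "t (g - h) = t g - t h" "t (g * h) = t g * t h" for g h
    by (simp_all add: s_def t_def swap_vars_diff swap_vars_mult)
  have tp: "(?x - ?z) * t (p g) = ?x * t g - ?z * t (s g)" for g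
    using arg_cong[OF p, of t g] by (simp add: hom)
  have sq: "(?x - ?z) * s (q g) = ?x * s g - ?z * s (t g)" for g
    using arg_cong[OF q, of s g] by (simp add: hom)
  have stp: "(?y - ?z) * s (t (p g)) = ?y * s (t g) - ?z * s (t (s g))" for g
    using arg_cong[OF tp, of s g] by (simp add: hom)
  have tsq: "(?x - ?y) * t (s (q g)) = ?x * t (s g) - ?y * t (s (t g))" for g
    using arg_cong[OF sq, of t g] by (simp add: hom)
  have sp: "s (p g) = p g" and tq: "t (q g) = q g" for g
    by (simp_all add: s_def t_def p_def q_def)
  let ?A = "?x * ?y * (?x * f - ?y * s f) - ?x * ?z * (?x * t f - ?z * t (s f)) +
    ?y * ?z * (?y * s (t f) - ?z * s (t (s f)))"
  have "(?x - ?y) * (?x - ?z) * (?y - ?z) * p (q (p f)) =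
      (?x - ?z) * (?y - ?z) * ((?x - ?y) * p (q (p f)))"
    by (simp only: mult_ac)
  also have "\<dots> = ?x * (?x - ?z) * ((?y - ?z) * q (p f)) -
      ?y * (?y - ?z) * ((?x - ?z) * s (q (p f)))"
    unfolding p[of "q (p f)"] by (simp add: algebra_simps)
  also have "\<dots> = ?x * ?y * ((?x - ?y) * p f) - ?x * ?z * ((?x - ?z) * t (p f)) +
      ?y * ?z * ((?y - ?z) * s (t (p f)))"
    unfolding q sq sp by (simp add: algebra_simps)
  also have "\<dots> = ?A"
    unfolding p tp stp ..
  finally have pqp: "(?x - ?y) * (?x - ?z) * (?y - ?z) * p (q (p f)) = ?A" .
  have "(?x - ?y) * (?x - ?z) * (?y - ?z) * q (p (q f)) =
      (?x - ?y) * (?x - ?z) * ((?y - ?z) * q (p (q f)))"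
    by (simp only: mult_ac)
  also have "\<dots> = ?y * (?x - ?z) * ((?x - ?y) * p (q f)) -
      ?z * (?x - ?y) * ((?x - ?z) * t (p (q f)))"
    unfolding q[of "p (q f)"] by (simp add: algebra_simps)
  also have "\<dots> = ?x * ?x * ((?y - ?z) * q f) - ?y * ?y * ((?x - ?z) * s (q f)) +
      ?z * ?z * ((?x - ?y) * t (s (q f)))"
    unfolding p tp tq by (simp add: algebra_simps)
  also have "\<dots> = ?x * ?x * (?y * f - ?z * t f) - ?y * ?y * (?x * s f - ?z * s (t f)) +
      ?z * ?z * (?x * t (s f) - ?y * t (s (t f)))"
    unfolding q sq tsq ..
  also have "t (s (t f)) = s (t (s f))"
    by (simp add: s_def t_def swap_vars_braid)
  finally have qpq: "(?x - ?y) * (?x - ?z) * (?y - ?z) * q (p (q f)) = ?A"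
    by (simp add: algebra_simps)
  have "(?x - ?y) * (?x - ?z) * (?y - ?z) * p (q (p f)) =
      (?x - ?y) * (?x - ?z) * (?y - ?z) * q (p (q f))"
    unfolding pqp qpq ..
  then have "p (q (p f)) = q (p (q f))"
    by simp
  then show ?thesis
    by (simp add: p_def q_def)
qed

lemma swap_entries_commute:
  assumes "Suc i < j" and "Suc j < length \<alpha>"
  shows "swap_entries i (swap_entries j \<alpha>) = swap_entries j (swap_entries i \<alpha>)"
  using assms by (intro nth_equalityI) (auto simp: swap_entries_def nth_list_update)

lemma swap_entries_braid:
  assumes "Suc (Suc i) < length \<alpha>"
  shows "swap_entries i (swap_entries (Suc i) (swap_entries i \<alpha>)) =
    swap_entries (Suc i) (swap_entries i (swap_entries (Suc i) \<alpha>))"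
  using assms by (intro nth_equalityI) (auto simp: swap_entries_def nth_list_update)

lemma ascent_swap_entries_far:
  assumes "ascent \<alpha> i" and "Suc i < j \<or> Suc j < i"
  shows "ascent (swap_entries j \<alpha>) i"
  using assms by (auto simp: ascent_def swap_entries_def nth_list_update)

text \<open>The recursion for key polynomials holds at every ascent.\<close>

lemma key_poly_ascent:
  assumes "ascent \<alpha> j"
  shows "key_poly \<alpha> = demazure j (key_poly (swap_entries j \<alpha>))"
  using assms
proof (induction "\<Sum>i<length \<alpha>. i * \<alpha> ! i" arbitrary: \<alpha> j rule: less_induct)
  case less
  have IH: "key_poly \<beta> = demazure i (key_poly (swap_entries i \<beta>))"
    if "(\<Sum>i<length \<beta>. i * \<beta> ! i) < (\<Sum>i<length \<alpha>. i * \<alpha> ! i)" "ascent \<beta> i" for \<beta> i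
    using less.hyps that by blast
  have same: "demazure i (key_poly (swap_entries i \<alpha>)) =
      demazure k (key_poly (swap_entries k \<alpha>))"
    if i: "ascent \<alpha> i" and k: "ascent \<alpha> k" and "i < k" for i k
  proof (cases "Suc i < k")
    case True
    have "key_poly (swap_entries i \<alpha>) =
        demazure k (key_poly (swap_entries k (swap_entries i \<alpha>)))"
      using True i k ascent_decreases[OF i] by (intro IH ascent_swap_entries_far) auto
    moreover have "key_poly (swap_entries k \<alpha>) =
        demazure i (key_poly (swap_entries i (swap_entries k \<alpha>)))"
      using True i k ascent_decreases[OF k] by (intro IH ascent_swap_entries_far) auto
    moreover have "swap_entries i (swap_entries k \<alpha>) = swap_entries k (swap_entries i \<alpha>)"
      using True k by (intro swap_entries_commute) (auto simp: ascent_def)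
    ultimately show ?thesis
      using demazure_commute[OF True] by simp
  next
    case False
    then have [simp]: "k = Suc i"
      using \<open>i < k\<close> by simp
    have len: "Suc (Suc i) < length \<alpha>"
      using k by (simp add: ascent_def)
    let ?s = "swap_entries i" and ?t = "swap_entries (Suc i)"
    have asc: "ascent (?s \<alpha>) (Suc i)" "ascent (?t (?s \<alpha>)) i"
      "ascent (?t \<alpha>) i" "ascent (?s (?t \<alpha>)) (Suc i)"
      using i k by (auto simp: ascent_def swap_entries_def nth_list_update)
    note dec = ascent_decreases[OF i] ascent_decreases[OF k]
      ascent_decreases[OF asc(1)] ascent_decreases[OF asc(3)]
    have "key_poly (?s \<alpha>) = demazure (Suc i) (key_poly (?t (?s \<alpha>)))"
      using dec asc by (intro IH) auto
    also have "key_poly (?t (?s \<alpha>)) = demazure i (key_poly (?s (?t (?s \<alpha>))))"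
      using dec asc by (intro IH) auto
    finally have s: "key_poly (?s \<alpha>) = demazure (Suc i) (demazure i (key_poly (?s (?t (?s \<alpha>)))))" .
    have "key_poly (?t \<alpha>) = demazure i (key_poly (?s (?t \<alpha>)))"
      using dec asc by (intro IH) auto
    also have "key_poly (?s (?t \<alpha>)) = demazure (Suc i) (key_poly (?t (?s (?t \<alpha>))))"
      using dec asc by (intro IH) auto
    finally have t: "key_poly (?t \<alpha>) = demazure i (demazure (Suc i) (key_poly (?t (?s (?t \<alpha>)))))" .
    show ?thesis
      using len by (simp add: s t demazure_braid swap_entries_braid)
  qed
  define k where "k = (SOME k. ascent \<alpha> k)"
  have k: "ascent \<alpha> k"
    unfolding k_def using less.prems by (rule someI)
  have "key_poly \<alpha> = demazure k (key_poly (swap_entries k \<alpha>))"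
    using less.prems
    by (subst key_poly.simps) (auto simp: weakly_decreasing_iff_no_ascent Let_def k_def)
  also have "\<dots> = demazure j (key_poly (swap_entries j \<alpha>))"
    using same[OF k less.prems] same[OF less.prems k] by (metis linorder_neqE_nat)
  finally show ?case .
qed

end

theory Submission
  imports Defs "HOL-Library.Multiset"
begin

text \<open>
  Avoiding the five patterns means that \<open>\<alpha>\<close> has no three increasing entries, and that two
  positions followed by two positions with larger entries always carry values \<open>c, c, c + 1, c +
  1\<close> (\<open>KM_shape\<close>; \<open>KM_shape_if_avoids\<close> and \<open>KM_shape_avoids\<close> give the equivalence).

  Such a composition is very rigid (\<open>KM_shape_cases\<close>). Unless its entries are all \<open>c\<close> or \<open>c +
  1\<close>, it can be cut as \<open>\<beta> @ \<gamma>\<close> with no entry of \<open>\<gamma>\<close> above an entry of \<open>\<beta>\<close>, if necessary after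
  exchanging the two entries next to the cut. Across such a cut the key polynomial factors into
  key polynomials in disjoint sets of variables (\<open>key_poly_append\<close>), and a product of
  multiplicity-free polynomials in disjoint variables is multiplicity-free. If the entries next
  to the cut had to be exchanged, a Demazure operator has to be applied to the product. It acts
  along the lines on which only the exponents of the two variables at the cut vary; since both
  factors are homogeneous, every such line meets the product in at most one monomial, with
  weakly decreasing exponents of these two variables, and that monomial is replaced by the
  monomials of a segment, each once (\<open>mult_free_demazure_append\<close>). By induction on the length
  the key polynomial is multiplicity-free; compositions with entries \<open>c\<close> and \<open>c + 1\<close> only are
  the base case (\<open>mult_free_key_poly_flat\<close>).

  For the converse one splits off the first column of the diagram of \<open>\<alpha>\<close>. With the Bruhat order
  on the rearrangements of \<open>\<alpha>\<close>, \<open>\<kappa>_\<alpha> = \<Sum>C. (\<Prod>i\<in>C. x_i) * \<kappa>_(M C - 1)\<close>, where \<open>C\<close> ranges over the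
  supports of the rearrangements below \<open>\<alpha>\<close>, \<open>M C\<close> is the largest of those with support \<open>C\<close>, and
  the subtraction of 1 applies to the nonzero entries (\<open>key_poly_column_expansion\<close>). This is a
  column-by-column form of the standard monomial description of Demazure characters. Induction
  on the largest entry then shows that key polynomials have nonnegative coefficients which
  increase along the Bruhat order (\<open>key_poly_mono\<close>). Consequently the coefficient of a monomial
  is at least 2 as soon as two different supports contribute to it. If \<open>\<alpha>\<close> contains a pattern,
  then after removing enough columns two explicit supports do (\<open>multiplicity_012\<close>,
  \<open>multiplicity_1022\<close>, \<open>multiplicity_0021\<close>).
\<close>

abbreviation lookup :: "('a \<Rightarrow>\<^sub>0 'b::zero) \<Rightarrow> 'a \<Rightarrow> 'b" where
  "lookup \<equiv> Poly_Mapping.lookup"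

abbreviation single :: "'a \<Rightarrow> 'b \<Rightarrow> 'a \<Rightarrow>\<^sub>0 'b::zero" where
  "single \<equiv> Poly_Mapping.single"

abbreviation keys :: "('a \<Rightarrow>\<^sub>0 'b::zero) \<Rightarrow> 'a set" where
  "keys \<equiv> Poly_Mapping.keys"

lemma sum_single_keys: "(\<Sum>m\<in>keys f. single m (lookup f m)) = f"
proof (rule poly_mapping_eqI)
  fix k
  have "(\<Sum>m\<in>keys f. lookup (single m (lookup f m)) k) = (\<Sum>m\<in>keys f. if m = k then lookup f m else 0)"
    by (rule sum.cong) (auto simp: lookup_single)
  also have "\<dots> = lookup f k"
    by (simp add: sum.delta in_keys_iff)
  finally show "lookup (\<Sum>m\<in>keys f. single m (lookup f m)) k = lookup f k"
    by (simp add: lookup_sum)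
qed

lemma mult_eq_sum_keys:
  "f * g = (\<Sum>a\<in>keys f. \<Sum>b\<in>keys g. single (a + b) (lookup f a * lookup g b))"
  for f g :: polynomial
proof -
  have "f * g = (\<Sum>a\<in>keys f. single a (lookup f a)) * (\<Sum>b\<in>keys g. single b (lookup g b))"
    by (simp add: sum_single_keys)
  then show ?thesis
    by (simp add: sum_product mult_single)
qed

section \<open>Demazure operators on monomials\<close>

lemma demazure_eqI:
  assumes "(var j - var (Suc j)) * g = var j * f - var (Suc j) * swap_vars j f"
  shows "demazure j f = g"
  using assms demazure_eq[of j f] demazure_unique[of j f] by blast

lemma demazure_0 [simp]: "demazure j 0 = 0"
  by (rule demazure_eqI) simp

lemma demazure_add: "demazure j (f + g) = demazure j f + demazure j g"
  by (rule demazure_eqI, simp only: distrib_left demazure_eq swap_vars_add)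
    (simp add: algebra_simps)

lemma demazure_sum: "demazure j (\<Sum>a\<in>A. f a) = (\<Sum>a\<in>A. demazure j (f a))"
  by (induction A rule: infinite_finite_induct) (simp_all add: demazure_add)

lemma demazure_mult_symmetric:
  assumes "swap_vars j h = h"
  shows "demazure j (h * f) = h * demazure j f"
proof (rule demazure_eqI)
  have "(var j - var (Suc j)) * (h * demazure j f) = h * ((var j - var (Suc j)) * demazure j f)"
    by (simp only: mult_ac)
  then show "(var j - var (Suc j)) * (h * demazure j f) =
      var j * (h * f) - var (Suc j) * swap_vars j (h * f)"
    unfolding demazure_eq swap_vars_mult assms by (simp add: algebra_simps)
qed

lemma demazure_symmetric:
  assumes "swap_vars j f = f"
  shows "demazure j f = f"
  using assms by (intro demazure_eqI) (simp add: algebra_simps)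

text \<open>
  The sum \<open>f + swap_vars j f\<close> is symmetric and hence fixed. This identity reduces the monomials
  whose exponents increase from \<open>j\<close> to \<open>Suc j\<close> to those whose exponents decrease.
\<close>

lemma demazure_add_swap: "demazure j f + demazure j (swap_vars j f) = f + swap_vars j f"
proof -
  have "demazure j (f + swap_vars j f) = f + swap_vars j f"
    by (rule demazure_symmetric) (simp add: swap_vars_add swap_vars_involutory add.commute)
  then show ?thesis
    by (simp add: demazure_add)
qed

lemma demazure_var_mult:
  "demazure j (var j * f) = var j * f + var (Suc j) * demazure j f"
proof (rule demazure_eqI)
  have "(var j - var (Suc j)) * (var j * f + var (Suc j) * demazure j f) =
      (var j - var (Suc j)) * (var j * f) + var (Suc j) * ((var j - var (Suc j)) * demazure j f)"
    by (simp only: distrib_left mult_ac)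
  then show "(var j - var (Suc j)) * (var j * f + var (Suc j) * demazure j f) =
      var j * (var j * f) - var (Suc j) * swap_vars j (var j * f)"
    unfolding demazure_eq by (simp add: swap_vars_mult swap_vars_var algebra_simps)
qed

lemma demazure_var_Suc_mult_symmetric:
  assumes "swap_vars j f = f"
  shows "demazure j (var (Suc j) * f) = 0"
  using assms by (intro demazure_eqI) (simp add: swap_vars_mult swap_vars_var)

text \<open>
  The points of the segment between \<open>m\<close> and \<open>swap_exponent j m\<close>; none if the exponents of \<open>m\<close>
  increase from \<open>j\<close> to \<open>Suc j\<close>, so that each segment is indexed by one of its two end points
  only.
\<close>

definition on_segment :: "nat \<Rightarrow> exponent \<Rightarrow> exponent \<Rightarrow> bool" where
  "on_segment j m m' \<longleftrightarrow>
     (\<forall>i. i \<noteq> j \<and> i \<noteq> Suc j \<longrightarrow> lookup m' i = lookup m i) \<and>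
     lookup m' j + lookup m' (Suc j) = lookup m j + lookup m (Suc j) \<and>
     lookup m (Suc j) \<le> lookup m' j \<and> lookup m' j \<le> lookup m j"

text \<open>
  Up to a symmetric factor the monomial is a power of \<open>var j\<close>, whose image is the complete
  homogeneous symmetric polynomial in the two variables, by the factorization of a difference of
  two powers.
\<close>

lemma demazure_single:
  assumes "lookup m (Suc j) \<le> lookup m j"
  shows "lookup (demazure j (single m 1)) m' = of_bool (on_segment j m m')"
proof -
  \<comment> \<open>The symmetric factor has exponent \<open>r\<close>.\<close>
  define d where "d = lookup m j - lookup m (Suc j)"
  define r where "r = m - single j d"
  have m: "m = r + single j d"
    by (rule poly_mapping_eqI) (auto simp: r_def d_def lookup_add lookup_minus lookup_single when_def)
  have sym: "swap_exponent j r = r"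
    using assms by (intro poly_mapping_eqI)
      (auto simp: r_def d_def lookup_swap_exponent lookup_minus lookup_single when_def transpose_def)
  define a where "a k = r + single j k + single (Suc j) (d - k)" for k
  have a: "lookup (a k) j = lookup m (Suc j) + k" "lookup (a k) (Suc j) = lookup m (Suc j) + (d - k)"
    "i \<noteq> j \<Longrightarrow> i \<noteq> Suc j \<Longrightarrow> lookup (a k) i = lookup m i" for k i
    using assms by (auto simp: a_def r_def d_def lookup_add lookup_minus lookup_single when_def)
  have "demazure j (var j ^ d) = (\<Sum>k<Suc d. var j ^ k * var (Suc j) ^ (d - k))"
  proof (rule demazure_eqI)
    have "swap_vars j (var j ^ d) = var (Suc j) ^ d"
      by (simp add: var_power swap_vars_single swap_exponent_single)
    then show "(var j - var (Suc j)) * (\<Sum>k<Suc d. var j ^ k * var (Suc j) ^ (d - k)) =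
        var j * var j ^ d - var (Suc j) * swap_vars j (var j ^ d)"
      unfolding diff_power_eq_sum[symmetric] by simp
  qed
  moreover have "single m 1 = single r 1 * var j ^ d"
    by (simp add: m var_power mult_single)
  ultimately have "demazure j (single m 1) =
      single r 1 * (\<Sum>k<Suc d. var j ^ k * var (Suc j) ^ (d - k))"
    using demazure_mult_symmetric[of j "single r 1" "var j ^ d"] by (simp add: swap_vars_single sym)
  also have "\<dots> = (\<Sum>k<Suc d. single (a k) 1)"
    by (simp only: sum_distrib_left var_power mult_single a_def mult_1 add.assoc)
  finally have "lookup (demazure j (single m 1)) m' = (\<Sum>k<Suc d. of_bool (a k = m'))"
    by (simp only: lookup_sum lookup_single when_def of_bool_def)
  also have "\<dots> = of_bool (on_segment j m m')"
  proof (cases "on_segment j m m'")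
    case False
    have "a k \<noteq> m'" if "k < Suc d" for k
    proof
      assume "a k = m'"
      then have "on_segment j m m'"
        using assms that a unfolding on_segment_def d_def by auto
      with False show False ..
    qed
    with False show ?thesis
      by simp
  next
    case True
    define k where "k = lookup m' j - lookup m (Suc j)"
    have seg: "\<And>i. i \<noteq> j \<Longrightarrow> i \<noteq> Suc j \<Longrightarrow> lookup m' i = lookup m i"
      "lookup m' j + lookup m' (Suc j) = lookup m j + lookup m (Suc j)"
      "lookup m (Suc j) \<le> lookup m' j" "lookup m' j \<le> lookup m j"
      using True by (auto simp: on_segment_def)
    have "a k = m'"
    proof (rule poly_mapping_eqI)
      fix i
      consider "i = j" | "i = Suc j" | "i \<noteq> j" "i \<noteq> Suc j"
        by blast
      then show "lookup (a k) i = lookup m' i"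
        using seg a assms by cases (auto simp: k_def d_def)
    qed
    moreover have "k < Suc d"
      using seg by (auto simp: k_def d_def)
    moreover have "a l = a l' \<Longrightarrow> l = l'" for l l'
      by (metis a(1) add_left_cancel)
    ultimately have "of_bool (a l = m') = (if l = k then 1 else 0 :: int)" for l
      by auto
    with True \<open>k < Suc d\<close> show ?thesis
      by (simp add: sum.delta)
  qed
  finally show ?thesis .
qed

lemma demazure_single_ascent:
  assumes "lookup m j < lookup m (Suc j)"
  shows "lookup (demazure j (single m 1)) m' =
    of_bool (m' = m) + of_bool (m' = swap_exponent j m) -
    of_bool (on_segment j (swap_exponent j m) m')"
proof -
  have "lookup (demazure j (single m 1)) m' + lookup (demazure j (single (swap_exponent j m) 1)) m' =
      of_bool (m' = m) + of_bool (m' = swap_exponent j m)"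
    using arg_cong[OF demazure_add_swap[of j "single m 1"], of "\<lambda>p. lookup p m'"]
    by (auto simp: swap_vars_single lookup_add lookup_single when_def)
  moreover have "lookup (demazure j (single (swap_exponent j m) 1)) m' =
      of_bool (on_segment j (swap_exponent j m) m')"
    using assms by (intro demazure_single) (simp add: lookup_swap_exponent)
  ultimately show ?thesis
    by simp
qed

lemma lookup_demazure:
  "lookup (demazure j f) m' = (\<Sum>m\<in>keys f. lookup f m * lookup (demazure j (single m 1)) m')"
proof -
  have const: "demazure j (single m c) = single 0 c * demazure j (single m 1)" for m and c :: int
  proof -
    have "single m c = single 0 c * single m 1"
      by (simp add: mult_single)
    moreover have "swap_vars j (single 0 c) = single 0 c"
      by (simp add: swap_vars_single swap_exponent_def)
    ultimately show ?thesis
      by (metis demazure_mult_symmetric)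
  qed
  have "lookup (single 0 c * g) m' = c * lookup g m'" for c :: int and g :: polynomial
    by (simp add: Poly_Mapping.map.rep_eq when_def flip: mult_map_scale_conv_mult)
  moreover have "demazure j f = (\<Sum>m\<in>keys f. demazure j (single m (lookup f m)))"
    by (simp add: sum_single_keys flip: demazure_sum)
  then have "demazure j f = (\<Sum>m\<in>keys f. single 0 (lookup f m) * demazure j (single m 1))"
    by (simp only: const[symmetric])
  ultimately show ?thesis
    by (simp add: lookup_sum)
qed

text \<open>
  Demazure operators preserve every convex condition on exponents that is symmetric in \<open>j\<close> and
  \<open>Suc j\<close>, because a new exponent lies on a segment whose end points are an old one and its
  reflection.
\<close>

lemma keys_demazure:
  assumes "m' \<in> keys (demazure j f)"
  obtains m where "m \<in> keys f" "on_segment j m m' \<or> on_segment j (swap_exponent j m) m'"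
proof -
  have "\<exists>m\<in>keys f. lookup (demazure j (single m 1)) m' \<noteq> 0"
    using assms unfolding in_keys_iff lookup_demazure[of j f]
    by (rule contrapos_np) (simp add: sum.neutral)
  then obtain m where m: "m \<in> keys f" "lookup (demazure j (single m 1)) m' \<noteq> 0" ..
  have "on_segment j m m' \<or> on_segment j (swap_exponent j m) m'"
  proof (cases "lookup m (Suc j) \<le> lookup m j")
    case True
    with m(2) show ?thesis
      by (simp add: demazure_single)
  next
    case False
    then have "on_segment j (swap_exponent j m) m \<and> on_segment j (swap_exponent j m) (swap_exponent j m)"
      by (auto simp: on_segment_def lookup_swap_exponent transpose_def)
    with False m(2) show ?thesis
      by (auto simp: demazure_single_ascent of_bool_def split: if_splits)
  qed
  with m(1) show ?thesis
    using that by blast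
qed

section \<open>Supports of key polynomials\<close>

lemma key_poly_induct [case_names decreasing ascent]:
  assumes "\<And>\<alpha>. sorted_wrt (\<ge>) \<alpha> \<Longrightarrow> P \<alpha>"
    and "\<And>\<alpha> j. ascent \<alpha> j \<Longrightarrow> P (swap_entries j \<alpha>) \<Longrightarrow> P \<alpha>"
  shows "P \<alpha>"
proof (induction "\<Sum>i<length \<alpha>. i * \<alpha> ! i" arbitrary: \<alpha> rule: less_induct)
  case less
  show ?case
  proof (cases "sorted_wrt (\<ge>) \<alpha>")
    case False
    then obtain j where "ascent \<alpha> j"
      by (auto simp: weakly_decreasing_iff_no_ascent)
    with less assms(2) ascent_decreases show ?thesis
      by (metis length_swap_entries)
  qed (fact assms(1))
qed

lemma key_poly_decreasing: "sorted_wrt (\<ge>) \<alpha> \<Longrightarrow> key_poly \<alpha> = monomial \<alpha>"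
  by (simp add: key_poly.simps)

lemma mset_swap_entries: "Suc j < length \<alpha> \<Longrightarrow> mset (swap_entries j \<alpha>) = mset \<alpha>"
  using mset_swap[of "Suc j" \<alpha> j] by (simp add: swap_entries_def)

lemma set_swap_entries: "Suc j < length \<alpha> \<Longrightarrow> set (swap_entries j \<alpha>) = set \<alpha>"
  by (metis mset_swap_entries set_mset_mset)

lemma sum_list_swap_entries:
  "Suc j < length \<alpha> \<Longrightarrow> sum_list (swap_entries j \<alpha>) = sum_list (\<alpha> :: nat list)"
  by (metis mset_swap_entries sum_mset_sum_list)

lemma swap_entries_swap_entries: "Suc j < length \<alpha> \<Longrightarrow> swap_entries j (swap_entries j \<alpha>) = \<alpha>"
  by (intro nth_equalityI) (auto simp: swap_entries_def nth_list_update)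

lemma sum_adjacent:
  fixes g :: "nat \<Rightarrow> nat"
  assumes "Suc j < n"
  shows "sum g {..<n} = g j + g (Suc j) + sum g ({..<n} - {j, Suc j})"
proof -
  have "{..<n} = insert j (insert (Suc j) ({..<n} - {j, Suc j}))"
    using assms by auto
  then have "sum g {..<n} = sum g (insert j (insert (Suc j) ({..<n} - {j, Suc j})))"
    by (rule arg_cong)
  then show ?thesis
    by simp
qed

text \<open>
  Homogeneity, and the bounds that the entries of \<open>\<alpha>\<close> impose on exponents: both hold for the
  leading monomial and survive Demazure operators.
\<close>

lemma keys_key_poly:
  assumes "m \<in> keys (key_poly \<alpha>)" and "\<And>x. x \<in> set \<alpha> \<Longrightarrow> lo \<le> x \<and> x \<le> hi"
  shows "(\<forall>i\<ge>length \<alpha>. lookup m i = 0) \<and> (\<forall>i<length \<alpha>. lo \<le> lookup m i \<and> lookup m i \<le> hi) \<and>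
    (\<Sum>i<length \<alpha>. lookup m i) = sum_list \<alpha>"
  using assms
proof (induction \<alpha> arbitrary: m rule: key_poly_induct)
  case (decreasing \<alpha>)
  then have "m = Poly_Mapping.nth \<alpha>"
    by (simp add: key_poly_decreasing monomial_eq_single)
  with decreasing show ?case
    by (auto simp: nth_default_def sum_list_sum_nth atLeast0LessThan)
next
  case (ascent \<alpha> j)
  have j: "Suc j < length \<alpha>"
    using ascent by (simp add: ascent_def)
  from ascent.prems(1) have "m \<in> keys (demazure j (key_poly (swap_entries j \<alpha>)))"
    by (simp flip: key_poly_ascent[OF ascent(1)])
  then obtain m0 where m0: "m0 \<in> keys (key_poly (swap_entries j \<alpha>))"
    and seg: "on_segment j m0 m \<or> on_segment j (swap_exponent j m0) m"
    by (rule keys_demazure)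
  have IH: "(\<forall>i\<ge>length \<alpha>. lookup m0 i = 0) \<and>
      (\<forall>i<length \<alpha>. lo \<le> lookup m0 i \<and> lookup m0 i \<le> hi) \<and>
      (\<Sum>i<length \<alpha>. lookup m0 i) = sum_list \<alpha>"
    using ascent.IH[OF m0] ascent.prems(2) j by (simp add: set_swap_entries sum_list_swap_entries)
  have other: "lookup m i = lookup m0 i" if "i \<noteq> j" "i \<noteq> Suc j" for i
    using seg that by (auto simp: on_segment_def lookup_swap_exponent transpose_def)
  have total: "lookup m j + lookup m (Suc j) = lookup m0 j + lookup m0 (Suc j)"
    using seg by (auto simp: on_segment_def lookup_swap_exponent transpose_def)
  have between: "min (lookup m0 j) (lookup m0 (Suc j)) \<le> lookup m j"
      "lookup m j \<le> max (lookup m0 j) (lookup m0 (Suc j))"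
    using seg by (auto simp: on_segment_def lookup_swap_exponent transpose_def)
  have b0: "lo \<le> lookup m0 j" "lookup m0 j \<le> hi" "lo \<le> lookup m0 (Suc j)" "lookup m0 (Suc j) \<le> hi"
    using IH j by (meson Suc_lessD)+
  have between': "min (lookup m0 j) (lookup m0 (Suc j)) \<le> lookup m (Suc j)"
      "lookup m (Suc j) \<le> max (lookup m0 j) (lookup m0 (Suc j))"
    using between total by (simp_all add: min_def max_def split: if_splits)
  have bj: "lo \<le> lookup m j \<and> lookup m j \<le> hi" "lo \<le> lookup m (Suc j) \<and> lookup m (Suc j) \<le> hi"
    using between between' b0 by linarith+
  have box: "lo \<le> lookup m i \<and> lookup m i \<le> hi" if "i < length \<alpha>" for i
  proof -
    consider "i = j" | "i = Suc j" | "i \<noteq> j" "i \<noteq> Suc j"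
      by blast
    then show ?thesis
      using IH that bj other by cases simp_all
  qed
  have "(\<Sum>i<length \<alpha>. lookup m i) = (\<Sum>i<length \<alpha>. lookup m0 i)"
    using total by (simp add: sum_adjacent[OF j] other)
  with IH box other j show ?case
    by auto
qed

lemma swap_vars_eqI:
  assumes "\<And>m. m \<in> keys f \<Longrightarrow> lookup m j = lookup m (Suc j)"
  shows "swap_vars j f = f"
proof (rule poly_mapping_eqI)
  fix m
  have fixed: "swap_exponent j m = m" if "lookup m j = lookup m (Suc j)" for m
    using that by (intro poly_mapping_eqI) (auto simp: lookup_swap_exponent transpose_def)
  have "swap_exponent j m = m" if "m \<in> keys f \<or> swap_exponent j m \<in> keys f"
    using that fixed assms swap_exponent_involutory by metis
  then show "lookup (swap_vars j f) m = lookup f m"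
    by (metis in_keys_iff lookup_swap_vars)
qed

lemma swap_vars_key_poly_outside: "length \<alpha> \<le> j \<Longrightarrow> swap_vars j (key_poly \<alpha>) = key_poly \<alpha>"
  using keys_key_poly[of _ \<alpha> 0 "Max (set \<alpha>)"] by (intro swap_vars_eqI) simp

section \<open>Multiplicity-freeness under Demazure operators\<close>

text \<open>
  Unlike \<open>multiplicity_free\<close>, this does not refer to a number of variables, so that it applies
  to polynomials in any set of variables.
\<close>

definition mult_free :: "polynomial \<Rightarrow> bool" where
  "mult_free f \<longleftrightarrow> (\<forall>m. lookup f m \<in> {0, 1})"

lemma mult_free_imp_multiplicity_free: "mult_free f \<Longrightarrow> multiplicity_free n f"
  by (simp add: mult_free_def multiplicity_free_def coefficient_def)

text \<open>
  The operator replaces a monomial with decreasing exponents by all monomials of its segment and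
  kills a monomial with \<open>lookup m (Suc j) = Suc (lookup m j)\<close>. So if no other monomials occur
  and the segments are disjoint, then all coefficients remain 0 or 1.
\<close>

lemma mult_free_demazure:
  assumes "mult_free f"
    and steep: "\<And>m. m \<in> keys f \<Longrightarrow> lookup m (Suc j) \<le> Suc (lookup m j)"
    and disjoint: "\<And>m1 m2 m'. \<lbrakk>m1 \<in> keys f; m2 \<in> keys f; on_segment j m1 m'; on_segment j m2 m'\<rbrakk> \<Longrightarrow> m1 = m2"
  shows "mult_free (demazure j f)"
proof -
  have "lookup (demazure j f) m' \<in> {0, 1}" for m'
  proof -
    have single: "lookup (demazure j (single m 1)) m' = of_bool (on_segment j m m')" if "m \<in> keys f" for m
    proof (cases "lookup m (Suc j) \<le> lookup m j")
      case True
      then show ?thesis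
        by (rule demazure_single)
    next
      case False
      with steep[OF that] have step: "lookup m (Suc j) = Suc (lookup m j)"
        by simp
      \<comment> \<open>The segment consists of its two end points, which cancel the two positive terms.\<close>
      have "on_segment j (swap_exponent j m) m' \<longleftrightarrow> m' = m \<or> m' = swap_exponent j m"
      proof
        assume "on_segment j (swap_exponent j m) m'"
        then have seg: "\<And>i. i \<noteq> j \<Longrightarrow> i \<noteq> Suc j \<Longrightarrow> lookup m' i = lookup m i"
          "lookup m' j + lookup m' (Suc j) = lookup m j + lookup m (Suc j)"
          "lookup m' j = lookup m j \<or> lookup m' j = lookup m (Suc j)"
          using step by (auto simp: on_segment_def lookup_swap_exponent transpose_def)
        show "m' = m \<or> m' = swap_exponent j m"
          using seg(3)
        proof
          assume "lookup m' j = lookup m j"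
          with seg have "lookup m' i = lookup m i" for i
            by (cases "i = j"; cases "i = Suc j") auto
          then show ?thesis
            by (simp add: poly_mapping_eqI)
        next
          assume "lookup m' j = lookup m (Suc j)"
          with seg have "lookup m' i = lookup (swap_exponent j m) i" for i
            by (cases "i = j"; cases "i = Suc j") (auto simp: lookup_swap_exponent transpose_def)
          then show ?thesis
            by (simp add: poly_mapping_eqI)
        qed
      qed (use step in \<open>auto simp: on_segment_def lookup_swap_exponent transpose_def\<close>)
      moreover have "m \<noteq> swap_exponent j m"
        using step lookup_swap_exponent[of j m j] by auto
      moreover have "\<not> on_segment j m m'"
        using step by (auto simp: on_segment_def)
      ultimately show ?thesis
        using step by (subst demazure_single_ascent) auto
    qed
    let ?S = "{m \<in> keys f. on_segment j m m'}"
    have "lookup f m = 1" if "m \<in> keys f" for m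
      using assms(1) that by (auto simp: mult_free_def in_keys_iff)
    then have "lookup (demazure j f) m' = (\<Sum>m\<in>keys f. of_bool (on_segment j m m'))"
      unfolding lookup_demazure[of j f] by (intro sum.cong) (simp_all add: single)
    also have "\<dots> = int (card ?S)"
      by (simp add: of_bool_def sum.If_cases Int_def)
    finally have "lookup (demazure j f) m' = int (card ?S)" .
    moreover have "card ?S \<le> 1"
      using disjoint by (intro card_le_Suc0_iff_eq[THEN iffD2, simplified One_nat_def[symmetric]]) auto
    ultimately show ?thesis
      by (auto simp: le_Suc_eq)
  qed
  then show ?thesis
    by (simp add: mult_free_def)
qed

text \<open>
  A monomial in two disjoint sets of variables determines the two monomials that it is a product
  of.
\<close>

lemma mult_free_mult:
  assumes "mult_free f" and "mult_free g"
    and "\<And>m i. m \<in> keys f \<Longrightarrow> p \<le> i \<Longrightarrow> lookup m i = 0"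
    and "\<And>m i. m \<in> keys g \<Longrightarrow> i < p \<Longrightarrow> lookup m i = 0"
  shows "mult_free (f * g)"
proof -
  have "lookup (f * g) m \<in> {0, 1}" for m
  proof -
    let ?S = "{z \<in> keys f \<times> keys g. fst z + snd z = m}"
    have one: "lookup f a = 1" "lookup g b = 1" if "a \<in> keys f" "b \<in> keys g" for a b
      using assms(1,2) that by (auto simp: mult_free_def in_keys_iff)
    have "f * g = (\<Sum>z\<in>keys f \<times> keys g. single (fst z + snd z) (lookup f (fst z) * lookup g (snd z)))"
      by (simp add: mult_eq_sum_keys sum.cartesian_product case_prod_beta)
    also have "\<dots> = (\<Sum>z\<in>keys f \<times> keys g. single (fst z + snd z) 1)"
      by (intro sum.cong) (auto simp: one)
    finally have "lookup (f * g) m = (\<Sum>z\<in>keys f \<times> keys g. of_bool (fst z + snd z = m))"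
      by (simp add: lookup_sum lookup_single when_def of_bool_def eq_commute[of m])
    also have "\<dots> = int (card ?S)"
      by (simp add: of_bool_def sum.If_cases Int_def)
    finally have "lookup (f * g) m = int (card ?S)" .
    moreover have "z = z'" if z: "z \<in> ?S" and z': "z' \<in> ?S" for z z'
    proof -
      have sum: "lookup (fst z) i + lookup (snd z) i = lookup (fst z') i + lookup (snd z') i" for i
        using z z' by (simp flip: lookup_add)
      have "lookup (fst z) i = lookup (fst z') i \<and> lookup (snd z) i = lookup (snd z') i" for i
        using sum[of i] assms(3)[of "fst z" i] assms(3)[of "fst z'" i]
          assms(4)[of "snd z" i] assms(4)[of "snd z'" i] z z' by (cases "p \<le> i") auto
      then show ?thesis
        by (simp add: prod_eq_iff poly_mapping_eqI)
    qed
    then have "card ?S \<le> 1"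
      by (intro card_le_Suc0_iff_eq[THEN iffD2, simplified One_nat_def[symmetric]]) auto
    ultimately show ?thesis
      by (auto simp: le_Suc_eq)
  qed
  then show ?thesis
    by (simp add: mult_free_def)
qed

section \<open>Factorization of key polynomials\<close>

lift_definition shift_exponent :: "nat \<Rightarrow> exponent \<Rightarrow> exponent" is
  "\<lambda>p m i. if i < p then 0 else m (i - p)"
proof -
  fix p and m :: "nat \<Rightarrow> nat"
  assume fin: "finite {i. m i \<noteq> 0}"
  have "i \<in> (+) p ` {i. m i \<noteq> 0}" if "(if i < p then 0 else m (i - p)) \<noteq> 0" for i
    using that by (intro image_eqI[of _ _ "i - p"]) (auto split: if_splits)
  then show "finite {i. (if i < p then 0 else m (i - p)) \<noteq> 0}"
    by (intro finite_surj[OF fin] subsetI) (simp only: mem_Collect_eq)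
qed

abbreviation unshift_exponent :: "nat \<Rightarrow> exponent \<Rightarrow> exponent" where
  "unshift_exponent p \<equiv> Poly_Mapping.map_key ((+) p)"

lemma lookup_unshift_exponent: "lookup (unshift_exponent p m) i = lookup m (p + i)"
  by (simp add: map_key.rep_eq)

lemma unshift_shift_exponent [simp]: "unshift_exponent p (shift_exponent p m) = m"
  by (rule poly_mapping_eqI) (simp add: lookup_unshift_exponent shift_exponent.rep_eq)

lemma shift_unshift_exponent:
  "(\<And>i. i < p \<Longrightarrow> lookup m i = 0) \<Longrightarrow> shift_exponent p (unshift_exponent p m) = m"
  by (rule poly_mapping_eqI) (simp add: lookup_unshift_exponent shift_exponent.rep_eq)

text \<open>
  The substitution of \<open>var (p + i)\<close> for \<open>var i\<close>; see \<open>shift_vars_var\<close> and \<open>shift_vars_mult\<close>.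
\<close>

lift_definition shift_vars :: "nat \<Rightarrow> polynomial \<Rightarrow> polynomial" is
  "\<lambda>p f m. if \<forall>i<p. lookup m i = 0 then f (unshift_exponent p m) else 0"
proof -
  fix p and f :: "exponent \<Rightarrow> int"
  assume fin: "finite {m. f m \<noteq> 0}"
  have "m \<in> shift_exponent p ` {m. f m \<noteq> 0}"
    if "(if \<forall>i<p. lookup m i = 0 then f (unshift_exponent p m) else 0) \<noteq> 0" for m
    using that by (intro image_eqI[of _ _ "unshift_exponent p m"])
      (auto simp: shift_unshift_exponent split: if_splits)
  then show "finite {m. (if \<forall>i<p. lookup m i = 0 then f (unshift_exponent p m) else 0) \<noteq> 0}"
    by (intro finite_surj[OF fin] subsetI) (simp only: mem_Collect_eq)
qed

lemma shift_vars_0 [simp]: "shift_vars p 0 = 0"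
  by (rule poly_mapping_eqI) (simp add: shift_vars.rep_eq)

lemma shift_vars_add: "shift_vars p (f + g) = shift_vars p f + shift_vars p g"
  by (rule poly_mapping_eqI) (auto simp: shift_vars.rep_eq lookup_add)

lemma shift_vars_diff: "shift_vars p (f - g) = shift_vars p f - shift_vars p g"
  by (rule poly_mapping_eqI) (auto simp: shift_vars.rep_eq lookup_minus)

lemma shift_exponent_add: "shift_exponent p (m + m') = shift_exponent p m + shift_exponent p m'"
  by (rule poly_mapping_eqI) (simp add: shift_exponent.rep_eq lookup_add)

lemma shift_vars_single: "shift_vars p (single m c) = single (shift_exponent p m) c"
proof (rule poly_mapping_eqI)
  fix k
  show "lookup (shift_vars p (single m c)) k = lookup (single (shift_exponent p m) c) k"
  proof (cases "\<forall>i<p. lookup k i = 0")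
    case True
    then have "shift_exponent p (unshift_exponent p k) = k"
      by (intro shift_unshift_exponent) blast
    then have "m = unshift_exponent p k \<longleftrightarrow> shift_exponent p m = k"
      by (metis unshift_shift_exponent)
    with True show ?thesis
      by (simp add: shift_vars.rep_eq lookup_single)
  next
    case False
    then have "shift_exponent p m \<noteq> k"
      by (auto simp: shift_exponent.rep_eq)
    with False show ?thesis
      by (auto simp: shift_vars.rep_eq lookup_single)
  qed
qed

lemma shift_vars_mult: "shift_vars p (f * g) = shift_vars p f * shift_vars p g"
proof (induction f rule: poly_mapping_single_induct)
  case (single_add m c f)
  have "shift_vars p (single m c * g) = shift_vars p (single m c) * shift_vars p g"
    by (induction g rule: poly_mapping_single_induct)
      (simp_all add: distrib_left shift_vars_add shift_vars_single mult_single shift_exponent_add)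
  with single_add show ?case
    by (simp add: distrib_right shift_vars_add)
qed simp

lemma shift_vars_var: "shift_vars p (var i) = var (p + i)"
proof -
  have "shift_exponent p (single i (1 :: nat)) = single (p + i) 1"
    by (rule poly_mapping_eqI) (auto simp: shift_exponent.rep_eq lookup_single when_def)
  then show ?thesis
    by (simp add: var_def shift_vars_single)
qed

lemma swap_vars_shift_vars: "swap_vars (p + j) (shift_vars p f) = shift_vars p (swap_vars j f)"
proof (rule poly_mapping_eqI)
  fix m
  have "swap_exponent j (unshift_exponent p m) = unshift_exponent p (swap_exponent (p + j) m)"
    by (rule poly_mapping_eqI)
      (auto simp: lookup_swap_exponent lookup_unshift_exponent transpose_def)
  moreover have "(\<forall>i<p. lookup (swap_exponent (p + j) m) i = 0) \<longleftrightarrow> (\<forall>i<p. lookup m i = 0)"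
    by (auto simp: lookup_swap_exponent transpose_def)
  ultimately show "lookup (swap_vars (p + j) (shift_vars p f)) m = lookup (shift_vars p (swap_vars j f)) m"
    by (auto simp: lookup_swap_vars shift_vars.rep_eq)
qed

lemma demazure_shift_vars: "demazure (p + j) (shift_vars p f) = shift_vars p (demazure j f)"
proof (rule demazure_eqI)
  show "(var (p + j) - var (Suc (p + j))) * shift_vars p (demazure j f) =
      var (p + j) * shift_vars p f - var (Suc (p + j)) * swap_vars (p + j) (shift_vars p f)"
    using arg_cong[OF demazure_eq[of j f], of "shift_vars p"]
    by (simp add: shift_vars_mult shift_vars_diff shift_vars_var swap_vars_shift_vars)
qed

lemma keys_shift_vars:
  assumes "m \<in> keys (shift_vars p f)"
  shows "i < p \<Longrightarrow> lookup m i = 0" and "unshift_exponent p m \<in> keys f"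
  using assms by (auto simp: in_keys_iff shift_vars.rep_eq split: if_splits)

lemma mult_free_shift_vars: "mult_free f \<Longrightarrow> mult_free (shift_vars p f)"
  by (simp add: mult_free_def shift_vars.rep_eq)

text \<open>
  The Demazure operators that sort \<open>\<beta>\<close> and those that sort \<open>\<gamma>\<close> act on disjoint sets of
  variables, and together they sort \<open>\<beta> @ \<gamma>\<close>, since the concatenation of the sorted parts is
  sorted.
\<close>

lemma key_poly_append:
  assumes "\<And>x y. x \<in> set \<beta> \<Longrightarrow> y \<in> set \<gamma> \<Longrightarrow> y \<le> x"
  shows "key_poly (\<beta> @ \<gamma>) = key_poly \<beta> * shift_vars (length \<beta>) (key_poly \<gamma>)"
  using assms
proof (induction \<beta> rule: key_poly_induct)
  case (decreasing \<beta>)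
  from decreasing(2) show ?case
  proof (induction \<gamma> rule: key_poly_induct)
    case (decreasing \<gamma>)
    with \<open>sorted_wrt (\<ge>) \<beta>\<close> have "sorted_wrt (\<ge>) (\<beta> @ \<gamma>)"
      by (auto simp: sorted_wrt_append)
    moreover have "Poly_Mapping.nth (\<beta> @ \<gamma>) =
        Poly_Mapping.nth \<beta> + shift_exponent (length \<beta>) (Poly_Mapping.nth \<gamma>)"
      by (rule poly_mapping_eqI)
        (auto simp: lookup_add shift_exponent.rep_eq nth_default_append nth_default_def nth_append)
    ultimately show ?case
      using \<open>sorted_wrt (\<ge>) \<beta>\<close> decreasing
      by (simp add: key_poly_decreasing monomial_eq_single shift_vars_single mult_single)
  next
    case (ascent \<gamma> j)
    let ?p = "length \<beta>"
    have j: "Suc j < length \<gamma>"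
      using ascent by (simp add: ascent_def)
    have "ascent (\<beta> @ \<gamma>) (?p + j)"
      using ascent(1) by (simp add: ascent_def nth_append)
    then have "key_poly (\<beta> @ \<gamma>) = demazure (?p + j) (key_poly (swap_entries (?p + j) (\<beta> @ \<gamma>)))"
      by (rule key_poly_ascent)
    also have "swap_entries (?p + j) (\<beta> @ \<gamma>) = \<beta> @ swap_entries j \<gamma>"
      using j by (simp add: swap_entries_def list_update_append nth_append)
    also have "key_poly (\<beta> @ swap_entries j \<gamma>) =
        key_poly \<beta> * shift_vars ?p (key_poly (swap_entries j \<gamma>))"
      using ascent j by (simp add: set_swap_entries)
    also have "demazure (?p + j) \<dots> = key_poly \<beta> * shift_vars ?p (demazure j (key_poly (swap_entries j \<gamma>)))"
      by (simp add: demazure_mult_symmetric swap_vars_key_poly_outside demazure_shift_vars)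
    finally show ?case
      by (simp flip: key_poly_ascent[OF ascent(1)])
  qed
next
  case (ascent \<beta> j)
  let ?g = "shift_vars (length \<beta>) (key_poly \<gamma>)"
  have j: "Suc j < length \<beta>"
    using ascent by (simp add: ascent_def)
  have "swap_vars j ?g = ?g"
    using j keys_shift_vars(1)[of _ "length \<beta>" "key_poly \<gamma>"] by (intro swap_vars_eqI) simp
  moreover have "ascent (\<beta> @ \<gamma>) j"
    using ascent(1) by (simp add: ascent_def nth_append)
  then have "key_poly (\<beta> @ \<gamma>) = demazure j (key_poly (swap_entries j (\<beta> @ \<gamma>)))"
    by (rule key_poly_ascent)
  moreover have "swap_entries j (\<beta> @ \<gamma>) = swap_entries j \<beta> @ \<gamma>"
    using j by (simp add: swap_entries_def list_update_append nth_append)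
  moreover have "key_poly (swap_entries j \<beta> @ \<gamma>) = key_poly (swap_entries j \<beta>) * ?g"
    using ascent j by (simp add: set_swap_entries)
  ultimately show ?case
    using demazure_mult_symmetric[of j ?g "key_poly (swap_entries j \<beta>)"]
    by (simp add: mult.commute key_poly_ascent[OF ascent(1)])
qed

section \<open>Compositions avoiding the patterns have multiplicity-free key polynomials\<close>

text \<open>
  The elementary form of the pattern conditions. The first clause excludes \<open>(0,1,2)\<close>. Given the
  first clause, the positions \<open>i\<close>, \<open>j\<close> and the positions \<open>k\<close>, \<open>l\<close> of the second clause carry
  weakly decreasing values; the four ways of choosing equality or strict decrease in both pairs
  are the four other patterns. Two equal low values followed by two equal high values avoid
  \<open>(0,0,2,2)\<close> exactly if they differ by 1.
\<close>

definition KM_shape :: "nat list \<Rightarrow> bool" where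
  "KM_shape \<alpha> \<longleftrightarrow>
     (\<forall>i j k. i < j \<and> j < k \<and> k < length \<alpha> \<longrightarrow> \<not> (\<alpha> ! i < \<alpha> ! j \<and> \<alpha> ! j < \<alpha> ! k)) \<and>
     (\<forall>i j k l. i < j \<and> j < k \<and> k < l \<and> l < length \<alpha> \<and>
        max (\<alpha> ! i) (\<alpha> ! j) < min (\<alpha> ! k) (\<alpha> ! l) \<longrightarrow>
        \<alpha> ! i = \<alpha> ! j \<and> \<alpha> ! k = Suc (\<alpha> ! j) \<and> \<alpha> ! l = Suc (\<alpha> ! j))"

lemma KM_shape_no_chain:
  "KM_shape \<alpha> \<Longrightarrow> i < j \<Longrightarrow> j < k \<Longrightarrow> k < length \<alpha> \<Longrightarrow> \<alpha> ! i < \<alpha> ! j \<Longrightarrow> \<alpha> ! k \<le> \<alpha> ! j"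
  unfolding KM_shape_def by (meson not_le)

lemma KM_shape_tight:
  assumes "KM_shape \<alpha>" "i < j" "j < k" "k < l" "l < length \<alpha>"
    and "max (\<alpha> ! i) (\<alpha> ! j) < min (\<alpha> ! k) (\<alpha> ! l)"
  shows "\<alpha> ! i = \<alpha> ! j" "\<alpha> ! k = Suc (\<alpha> ! j)" "\<alpha> ! l = Suc (\<alpha> ! j)"
  using assms unfolding KM_shape_def by blast+

lemma KM_shape_subsequence:
  assumes \<alpha>: "KM_shape \<alpha>" and mono: "\<And>i j. i < j \<Longrightarrow> j < length \<beta> \<Longrightarrow> f i < f j"
    and nth: "\<And>i. i < length \<beta> \<Longrightarrow> f i < length \<alpha> \<and> \<beta> ! i = \<alpha> ! f i"
  shows "KM_shape \<beta>"
  unfolding KM_shape_def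
proof (intro conjI allI impI)
  fix i j k
  assume ijk: "i < j \<and> j < k \<and> k < length \<beta>"
  then have "f i < f j" "f j < f k" "f k < length \<alpha>"
    using mono nth by auto
  then show "\<not> (\<beta> ! i < \<beta> ! j \<and> \<beta> ! j < \<beta> ! k)"
    using ijk nth KM_shape_no_chain[OF \<alpha>, of "f i" "f j" "f k"] by fastforce
next
  fix i j k l
  assume ijkl: "i < j \<and> j < k \<and> k < l \<and> l < length \<beta> \<and> max (\<beta> ! i) (\<beta> ! j) < min (\<beta> ! k) (\<beta> ! l)"
  then have f: "f i < f j" "f j < f k" "f k < f l" "f l < length \<alpha>"
    using mono nth by auto
  have eq: "\<beta> ! i = \<alpha> ! f i" "\<beta> ! j = \<alpha> ! f j" "\<beta> ! k = \<alpha> ! f k" "\<beta> ! l = \<alpha> ! f l"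
    using ijkl nth by auto
  show "\<beta> ! i = \<beta> ! j" "\<beta> ! k = Suc (\<beta> ! j)" "\<beta> ! l = Suc (\<beta> ! j)"
    using KM_shape_tight[OF \<alpha> f] ijkl unfolding eq by auto
qed

text \<open>
  Let \<open>M\<close> be the largest entry, \<open>h\<close> its last position, and \<open>y\<close> the last position before \<open>h\<close> at
  which the entries before \<open>h\<close> attain their minimum. If there is no such position, or if this
  minimum is \<open>M\<close>, then \<open>\<alpha>\<close> starts with \<open>M\<close> and can be cut after its first entry, unless this is
  its only entry. Otherwise, as there are no three increasing entries, \<open>M\<close> stands right after
  \<open>y\<close>, and the cut is between these two positions, with their entries exchanged. An obstruction
  would be an entry left of \<open>y\<close> smaller than an entry right of the cut. Together with the
  entries at the cut it violates the second clause of \<open>KM_shape\<close>, unless all entries up to \<open>h\<close>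
  are \<open>M - 1\<close> or \<open>M\<close>; in that case \<open>\<alpha>\<close> ends at \<open>h\<close> or can be cut right after it.
\<close>

lemma KM_shape_cases:
  assumes "KM_shape \<alpha>"
  obtains (flat) c where "set \<alpha> \<subseteq> {c, Suc c}"
  | (split) \<beta> \<gamma> where "\<alpha> = \<beta> @ \<gamma>" "\<beta> \<noteq> []" "\<gamma> \<noteq> []"
      "\<And>x y. x \<in> set \<beta> \<Longrightarrow> y \<in> set \<gamma> \<Longrightarrow> y \<le> x"
  | (swapped) j where "ascent \<alpha> j"
      "\<And>i l. i < j \<Longrightarrow> Suc j < l \<Longrightarrow> l < length \<alpha> \<Longrightarrow> \<alpha> ! l \<le> \<alpha> ! i"
      "\<And>i. i < j \<Longrightarrow> \<alpha> ! j \<le> \<alpha> ! i"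
      "\<And>l. Suc j < l \<Longrightarrow> l < length \<alpha> \<Longrightarrow> \<alpha> ! l \<le> \<alpha> ! Suc j"
proof (cases "\<alpha> = []")
  case True
  then show ?thesis
    using that(1)[of 0] by simp
next
  case False
  note result = that
  have split: thesis if "0 < p" "p < length \<alpha>"
    "\<And>i l. i < p \<Longrightarrow> p \<le> l \<Longrightarrow> l < length \<alpha> \<Longrightarrow> \<alpha> ! l \<le> \<alpha> ! i" for p
  proof (rule result(2)[of "take p \<alpha>" "drop p \<alpha>"])
    fix x y
    assume x: "x \<in> set (take p \<alpha>)" and y: "y \<in> set (drop p \<alpha>)"
    obtain i where "i < p" "x = \<alpha> ! i"
      using x by (auto simp: in_set_conv_nth)
    moreover obtain l where "l < length (drop p \<alpha>)" "y = drop p \<alpha> ! l"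
      using y by (metis in_set_conv_nth)
    ultimately show "y \<le> x"
      using that(3)[of i "p + l"] by simp
  qed (use \<open>0 < p\<close> \<open>p < length \<alpha>\<close> False in auto)
  define M where "M = Max (set \<alpha>)"
  define h where "h = Max {i. i < length \<alpha> \<and> \<alpha> ! i = M}"
  have M: "\<alpha> ! i \<le> M" if "i < length \<alpha>" for i
    using that by (simp add: M_def)
  have "M \<in> set \<alpha>"
    using False by (simp add: M_def)
  then have "{i. i < length \<alpha> \<and> \<alpha> ! i = M} \<noteq> {}"
    by (auto simp: in_set_conv_nth)
  then have h: "h < length \<alpha>" "\<alpha> ! h = M"
    using Max_in[of "{i. i < length \<alpha> \<and> \<alpha> ! i = M}"] by (auto simp: h_def)
  have after: "\<alpha> ! i < M" if "h < i" "i < length \<alpha>" for i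
  proof -
    have "\<alpha> ! i \<noteq> M"
    proof
      assume "\<alpha> ! i = M"
      with that(2) have "i \<le> h"
        unfolding h_def by (intro Max_ge) auto
      with that(1) show False
        by simp
    qed
    with M[OF that(2)] show ?thesis
      by simp
  qed
  show ?thesis
  proof (cases "h = 0")
    case True
    show ?thesis
    proof (cases "length \<alpha> = 1")
      case True
      then show ?thesis
        by (intro result(1)[of "\<alpha> ! 0"]) (auto simp: in_set_conv_nth)
    next
      case False
      with \<open>\<alpha> \<noteq> []\<close> have "1 < length \<alpha>"
        by (cases \<alpha>) auto
      with \<open>h = 0\<close> h M show ?thesis
        by (intro split[of 1]) auto
    qed
  next
    case False
    define v where "v = Min ((!) \<alpha> ` {..<h})"
    define y where "y = Max {i. i < h \<and> \<alpha> ! i = v}"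
    have v: "v \<le> \<alpha> ! i" if "i < h" for i
      using that by (simp add: v_def)
    have "v \<in> (!) \<alpha> ` {..<h}"
      unfolding v_def using False by (intro Min_in) auto
    then have "{i. i < h \<and> \<alpha> ! i = v} \<noteq> {}"
      by auto
    then have y: "y < h" "\<alpha> ! y = v"
      using Max_in[of "{i. i < h \<and> \<alpha> ! i = v}"] by (auto simp: y_def)
    have between: "v < \<alpha> ! i" if "y < i" "i < h" for i
    proof -
      have "\<alpha> ! i \<noteq> v"
      proof
        assume "\<alpha> ! i = v"
        with that(2) have "i \<le> y"
          unfolding y_def by (intro Max_ge) auto
        with that(1) show False
          by simp
      qed
      with v[OF that(2)] show ?thesis
        by simp
    qed
    show ?thesis
    proof (cases "v = M")
      case True
      then have "\<alpha> ! 0 = M"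
        using v[of 0] M[of 0] h False by fastforce
      with M h False show ?thesis
        by (intro split[of 1]) auto
    next
      case False
      then have "v < M"
        using M[of y] y h by simp
      \<comment> \<open>Otherwise the positions \<open>y\<close>, \<open>Suc y\<close> and \<open>h\<close> would carry increasing entries.\<close>
      have top: "\<alpha> ! Suc y = M"
      proof (cases "Suc y = h")
        case False
        then have "M \<le> \<alpha> ! Suc y"
          using KM_shape_no_chain[OF assms, of y "Suc y" h] between[of "Suc y"] y h by auto
        with M[of "Suc y"] y h show ?thesis
          by simp
      qed (use h in simp)
      have "ascent \<alpha> y"
        using y h top \<open>v < M\<close> by (simp add: ascent_def)
      show ?thesis
      proof (cases "\<forall>i l. i < y \<longrightarrow> Suc y < l \<longrightarrow> l < length \<alpha> \<longrightarrow> \<alpha> ! l \<le> \<alpha> ! i")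
        case True
        then show ?thesis
          using \<open>ascent \<alpha> y\<close> v y M top h by (intro result(3)[of y]) auto
      next
        case False
        then obtain i l where il: "i < y" "Suc y < l" "l < length \<alpha>" "\<alpha> ! i < \<alpha> ! l"
          by (auto simp: not_le)
        have "v \<le> \<alpha> ! i" "\<alpha> ! l \<le> M"
          using v[of i] M[of l] il y by auto
        then have "M = Suc v"
          using KM_shape_tight(2)[OF assms, of i y "Suc y" l] il y top by auto
        show ?thesis
        proof (cases "Suc h < length \<alpha>")
          case True
          show ?thesis
          proof (rule split[of "Suc h"])
            fix i l
            assume "i < Suc h" "Suc h \<le> l" "l < length \<alpha>"
            then have "\<alpha> ! l \<le> v"
              using after[of l] \<open>M = Suc v\<close> by simp
            moreover have "v \<le> \<alpha> ! i"
              using v[of i] h \<open>v < M\<close> \<open>i < Suc h\<close> by (cases "i = h") auto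
            ultimately show "\<alpha> ! l \<le> \<alpha> ! i"
              by simp
          qed (use True in auto)
        next
          case False
          have "\<alpha> ! i \<in> {v, Suc v}" if "i < length \<alpha>" for i
          proof (cases "i = h")
            case False
            with that \<open>\<not> Suc h < length \<alpha>\<close> have "i < h"
              by simp
            with v[of i] M[OF that] \<open>M = Suc v\<close> show ?thesis
              by auto
          qed (use h \<open>M = Suc v\<close> in simp)
          then have "set \<alpha> \<subseteq> {v, Suc v}"
            by (metis in_set_conv_nth subsetI)
          then show ?thesis
            by (rule result(1))
        qed
      qed
    qed
  qed
qed

text \<open>
  All exponents are \<open>c\<close> or \<open>Suc c\<close>, so a Demazure operator only ever sees segments of at most
  two points.
\<close>

lemma mult_free_key_poly_flat:
  assumes "set \<alpha> \<subseteq> {c, Suc c}"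
  shows "mult_free (key_poly \<alpha>)"
  using assms
proof (induction \<alpha> rule: key_poly_induct)
  case (decreasing \<alpha>)
  then show ?case
    by (simp add: key_poly_decreasing monomial_eq_single mult_free_def lookup_single when_def)
next
  case (ascent \<alpha> j)
  let ?f = "key_poly (swap_entries j \<alpha>)"
  have j: "Suc j < length \<alpha>"
    using ascent by (simp add: ascent_def)
  have box: "c \<le> lookup m i \<and> lookup m i \<le> Suc c" if "m \<in> keys ?f" "i < length \<alpha>" for m i
  proof -
    have "c \<le> x \<and> x \<le> Suc c" if "x \<in> set (swap_entries j \<alpha>)" for x
      using that ascent.prems j by (auto simp: set_swap_entries)
    from keys_key_poly[OF that(1) this] that(2) show ?thesis
      by simp
  qed
  have "mult_free (demazure j ?f)"
  proof (rule mult_free_demazure)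
    show "mult_free ?f"
      using ascent j by (simp add: set_swap_entries)
  next
    fix m
    assume "m \<in> keys ?f"
    then show "lookup m (Suc j) \<le> Suc (lookup m j)"
      using box[of m j] box[of m "Suc j"] j by auto
  next
    fix m1 m2 m'
    assume m: "m1 \<in> keys ?f" "m2 \<in> keys ?f"
      and seg: "on_segment j m1 m'" "on_segment j m2 m'"
    show "m1 = m2"
    proof (rule poly_mapping_eqI)
      fix i
      show "lookup m1 i = lookup m2 i"
        using seg m box[of m1 j] box[of m1 "Suc j"] box[of m2 j] box[of m2 "Suc j"] j
        unfolding on_segment_def by (cases "i = j"; cases "i = Suc j") auto
    qed
  qed
  then show ?case
    by (simp flip: key_poly_ascent[OF ascent(1)])
qed

lemma mult_free_key_poly_append:
  assumes "\<And>x y. x \<in> set \<beta> \<Longrightarrow> y \<in> set \<gamma> \<Longrightarrow> y \<le> x"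
    and "mult_free (key_poly \<beta>)" and "mult_free (key_poly \<gamma>)"
  shows "mult_free (key_poly (\<beta> @ \<gamma>))"
proof -
  have "mult_free (key_poly \<beta> * shift_vars (length \<beta>) (key_poly \<gamma>))"
  proof (rule mult_free_mult[where p = "length \<beta>"])
  fix m i
  assume "m \<in> keys (key_poly \<beta>)" "length \<beta> \<le> i"
  then show "lookup m i = 0"
    using keys_key_poly[of m \<beta> 0 "Max (set \<beta>)"] by simp
  qed (use assms keys_shift_vars in \<open>auto intro: mult_free_shift_vars\<close>)
  then show ?thesis
    using assms(1) by (subst key_poly_append) auto
qed

text \<open>
  The degree in the first \<open>length \<beta>\<close> variables is constant on the product of the two key
  polynomials. So two of its monomials that differ only in the exponents of \<open>var j\<close> and \<open>var
  (Suc j)\<close>, with the same total degree, are equal. Moreover the exponent of \<open>var j\<close> is at least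
  every entry of \<open>\<gamma>\<close>, and the exponent of \<open>var (Suc j)\<close> is at most the largest entry of \<open>\<gamma>\<close>.
\<close>

lemma mult_free_demazure_append:
  assumes le: "\<And>x y. x \<in> set \<beta> \<Longrightarrow> y \<in> set \<gamma> \<Longrightarrow> y \<le> x"
    and "mult_free (key_poly \<beta>)" and "mult_free (key_poly \<gamma>)"
    and j: "length \<beta> = Suc j" and "\<gamma> \<noteq> []"
  shows "mult_free (demazure j (key_poly (\<beta> @ \<gamma>)))"
proof -
  define t where "t = Max (set \<gamma>)"
  have *: "lookup m (Suc j) \<le> t \<and> t \<le> lookup m j \<and> (\<Sum>i<Suc j. lookup m i) = sum_list \<beta>"
    if m: "m \<in> keys (key_poly (\<beta> @ \<gamma>))" for m
  proof -
    obtain a b where m_eq: "m = a + b" and a: "a \<in> keys (key_poly \<beta>)"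
      and b: "b \<in> keys (shift_vars (Suc j) (key_poly \<gamma>))"
      using m keys_mult by (fastforce simp: key_poly_append[of \<beta> \<gamma>, OF le] j)
    have "t \<in> set \<gamma>"
      using \<open>\<gamma> \<noteq> []\<close> by (simp add: t_def)
    then have a: "t \<le> lookup a j" "lookup a (Suc j) = 0" "(\<Sum>i<Suc j. lookup a i) = sum_list \<beta>"
      using keys_key_poly[OF a, of t "Max (set \<beta>)"] le j by auto
    have "lookup (unshift_exponent (Suc j) b) 0 \<le> t"
      using keys_key_poly[OF keys_shift_vars(2)[OF b], of 0 t] \<open>\<gamma> \<noteq> []\<close>
      by (simp add: t_def)
    then have "lookup b (Suc j) \<le> t"
      by (simp add: lookup_unshift_exponent)
    moreover have "lookup b i = 0" if "i < Suc j" for i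
      using keys_shift_vars(1)[OF b that] .
    ultimately show ?thesis
      using a by (simp add: m_eq lookup_add)
  qed
  show ?thesis
  proof (rule mult_free_demazure)
    show "mult_free (key_poly (\<beta> @ \<gamma>))"
      using assms by (intro mult_free_key_poly_append)
  next
    fix m
    assume "m \<in> keys (key_poly (\<beta> @ \<gamma>))"
    from *[OF this] show "lookup m (Suc j) \<le> Suc (lookup m j)"
      by simp
  next
    fix m1 m2 m'
    assume m: "m1 \<in> keys (key_poly (\<beta> @ \<gamma>))" "m2 \<in> keys (key_poly (\<beta> @ \<gamma>))"
      and seg: "on_segment j m1 m'" "on_segment j m2 m'"
    have other: "lookup m1 i = lookup m2 i" if "i \<noteq> j" "i \<noteq> Suc j" for i
      using seg that by (simp add: on_segment_def)
    then have "(\<Sum>i<j. lookup m1 i) = (\<Sum>i<j. lookup m2 i)"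
      by simp
    with *[OF m(1)] *[OF m(2)] have "lookup m1 j = lookup m2 j"
      by simp
    moreover from this seg have "lookup m1 (Suc j) = lookup m2 (Suc j)"
      by (auto simp: on_segment_def)
    ultimately show "m1 = m2"
      using other by (metis poly_mapping_eqI)
  qed
qed

theorem mult_free_key_poly:
  assumes "KM_shape \<alpha>"
  shows "mult_free (key_poly \<alpha>)"
  using assms
proof (induction "length \<alpha>" arbitrary: \<alpha> rule: less_induct)
  case less
  from less.prems show ?case
  proof (cases rule: KM_shape_cases)
    case flat
    then show ?thesis
      by (rule mult_free_key_poly_flat)
  next
    case (split \<beta> \<gamma>)
    have "KM_shape \<beta>"
      using less.prems by (rule KM_shape_subsequence[where f = "\<lambda>i. i"])
        (auto simp: split nth_append)
    moreover have "KM_shape \<gamma>"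
      using less.prems by (rule KM_shape_subsequence[where f = "\<lambda>i. length \<beta> + i"])
        (auto simp: split nth_append)
    ultimately show ?thesis
      unfolding split(1) using split less.hyps by (intro mult_free_key_poly_append) auto
  next
    case (swapped j)
    have j: "Suc j < length \<alpha>"
      using swapped by (simp add: ascent_def)
    define \<beta> where "\<beta> = take j \<alpha> @ [\<alpha> ! Suc j]"
    define \<gamma> where "\<gamma> = \<alpha> ! j # drop (Suc (Suc j)) \<alpha>"
    have len: "length \<beta> = Suc j" "length \<gamma> = length \<alpha> - Suc j"
      using j by (auto simp: \<beta>_def \<gamma>_def)
    have nth\<beta>: "\<beta> ! i = \<alpha> ! (if i < j then i else Suc j)" if "i < length \<beta>" for i
      using that j by (auto simp: \<beta>_def nth_append)
    have nth\<gamma>: "\<gamma> ! i = \<alpha> ! (if i = 0 then j else Suc j + i)" if "i < length \<gamma>" for i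
      using that j by (auto simp: \<gamma>_def nth_Cons split: nat.splits)
    have swap: "swap_entries j \<alpha> = \<beta> @ \<gamma>"
    proof (rule nth_equalityI)
      fix i assume "i < length (swap_entries j \<alpha>)"
      then show "swap_entries j \<alpha> ! i = (\<beta> @ \<gamma>) ! i"
        using j by (auto simp: swap_entries_def nth_append nth_list_update nth\<beta> nth\<gamma> len)
    qed (use j len in simp)
    have "KM_shape \<beta>"
      using less.prems
      by (rule KM_shape_subsequence[where f = "\<lambda>i. if i < j then i else Suc j"])
        (use j nth\<beta> in \<open>auto simp: \<beta>_def\<close>)
    moreover have "KM_shape \<gamma>"
      using less.prems
      by (rule KM_shape_subsequence[where f = "\<lambda>i. if i = 0 then j else Suc j + i"])
        (use j nth\<gamma> in \<open>auto simp: \<gamma>_def\<close>)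
    moreover have "y \<le> x" if "x \<in> set \<beta>" "y \<in> set \<gamma>" for x y
    proof -
      obtain i l where "i < length \<beta>" "x = \<alpha> ! (if i < j then i else Suc j)"
        "l < length \<gamma>" "y = \<alpha> ! (if l = 0 then j else Suc j + l)"
        using \<open>x \<in> set \<beta>\<close> \<open>y \<in> set \<gamma>\<close> nth\<beta> nth\<gamma> by (metis in_set_conv_nth)
      moreover have "\<alpha> ! j \<le> \<alpha> ! Suc j"
        using swapped(1) by (simp add: ascent_def)
      ultimately show ?thesis
        using swapped j by (auto simp: \<gamma>_def)
    qed
    ultimately have "mult_free (demazure j (key_poly (\<beta> @ \<gamma>)))"
      using less.hyps j by (intro mult_free_demazure_append) (auto simp: \<beta>_def \<gamma>_def)
    then show ?thesis
      by (simp add: key_poly_ascent[OF swapped(1)] swap)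
  qed
qed

section \<open>Bruhat order on compositions\<close>

definition count_above :: "nat list \<Rightarrow> nat \<Rightarrow> nat \<Rightarrow> nat" where
  "count_above v p t = (\<Sum>i<p. of_bool (t < v ! i))"

text \<open>
  The tableau criterion for the Bruhat order on the rearrangements of a composition. Decreasing
  compositions are minimal, and the equality of the total counts says that the two compositions
  are rearrangements of each other.
\<close>

definition bruhat_le :: "nat list \<Rightarrow> nat list \<Rightarrow> bool" where
  "bruhat_le v w \<longleftrightarrow> length v = length w \<and>
     (\<forall>t. count_above v (length w) t = count_above w (length w) t) \<and>
     (\<forall>p\<le>length w. \<forall>t. count_above w p t \<le> count_above v p t)"

lemma bruhat_leI:
  assumes "length v = length w" and "\<And>t. count_above v (length w) t = count_above w (length w) t"
    and "\<And>p t. p \<le> length w \<Longrightarrow> count_above w p t \<le> count_above v p t"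
  shows "bruhat_le v w"
  using assms by (simp add: bruhat_le_def)

lemma bruhat_leD:
  assumes "bruhat_le v w"
  shows "length v = length w" and "count_above v (length w) t = count_above w (length w) t"
    and "p \<le> length w \<Longrightarrow> count_above w p t \<le> count_above v p t"
  using assms by (simp_all add: bruhat_le_def)

lemma bruhat_le_refl [simp]: "bruhat_le v v"
  by (simp add: bruhat_le_def)

lemma bruhat_le_trans: "bruhat_le u v \<Longrightarrow> bruhat_le v w \<Longrightarrow> bruhat_le u w"
  unfolding bruhat_le_def by (metis le_trans)

lemma count_above_Suc: "count_above v (Suc p) t = count_above v p t + of_bool (t < v ! p)"
  by (simp add: count_above_def)

lemma count_above_swap_entries:
  assumes "Suc i < length w"
  shows "count_above (swap_entries i w) p t =
    (if p = Suc i then count_above w i t + of_bool (t < w ! Suc i) else count_above w p t)"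
proof -
  have other: "swap_entries i w ! k = w ! k" if "k \<noteq> i" "k \<noteq> Suc i" for k
    using that by (simp add: swap_entries_def)
  have two: "swap_entries i w ! i = w ! Suc i" "swap_entries i w ! Suc i = w ! i"
    using assms by (simp_all add: swap_entries_def)
  have small: "count_above (swap_entries i w) p t = count_above w p t" if "p \<le> i" for p
    unfolding count_above_def using that other by (intro sum.cong) auto
  consider "p \<le> i" | "p = Suc i" | "Suc i < p"
    by linarith
  then show ?thesis
  proof cases
    case 3
    have "(\<Sum>k\<in>{..<p} - {i, Suc i}. of_bool (t < swap_entries i w ! k)) =
        (\<Sum>k\<in>{..<p} - {i, Suc i}. of_bool (t < w ! k) :: nat)"
      using other by (intro sum.cong) auto
    with 3 show ?thesis
      unfolding count_above_def sum_adjacent[OF 3] by (simp add: two)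
  qed (use small in \<open>simp_all add: count_above_Suc two\<close>)
qed

text \<open>
  This and the next lemma are the lifting property. Exchanging adjacent entries changes only the
  counts of the prefix that ends between them, and these are controlled by the two neighbouring
  prefixes, as each of the two entries adds at most 1.
\<close>

lemma bruhat_le_swap_entries_right:
  assumes "bruhat_le v w" and "Suc i < length w" and "v ! Suc i \<le> v ! i"
  shows "bruhat_le v (swap_entries i w)"
proof (rule bruhat_leI)
  show "length v = length (swap_entries i w)"
    using bruhat_leD(1)[OF assms(1)] by simp
  show "count_above v (length (swap_entries i w)) t =
      count_above (swap_entries i w) (length (swap_entries i w)) t" for t
    using assms(2) bruhat_leD(2)[OF assms(1)] by (simp add: count_above_swap_entries)
  fix p t
  assume "p \<le> length (swap_entries i w)"
  then show "count_above (swap_entries i w) p t \<le> count_above v p t"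
    using assms(2,3) bruhat_leD(3)[OF assms(1), of p t] bruhat_leD(3)[OF assms(1), of i t]
      bruhat_leD(3)[OF assms(1), of "Suc (Suc i)" t]
    by (auto simp: count_above_swap_entries count_above_Suc of_bool_def split: if_splits)
qed

lemma bruhat_le_swap_entries_left:
  assumes "bruhat_le v w" and "Suc i < length w" and "w ! i \<le> w ! Suc i"
  shows "bruhat_le (swap_entries i v) w"
proof (rule bruhat_leI)
  have len: "length v = length w"
    by (rule bruhat_leD(1)[OF assms(1)])
  then show "length (swap_entries i v) = length w"
    by simp
  show "count_above (swap_entries i v) (length w) t = count_above w (length w) t" for t
    using assms(2) len bruhat_leD(2)[OF assms(1)] by (simp add: count_above_swap_entries)
  fix p t
  assume "p \<le> length w"
  then show "count_above w p t \<le> count_above (swap_entries i v) p t"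
    using assms(2,3) len bruhat_leD(3)[OF assms(1), of p t] bruhat_leD(3)[OF assms(1), of i t]
      bruhat_leD(3)[OF assms(1), of "Suc (Suc i)" t]
    by (auto simp: count_above_swap_entries count_above_Suc of_bool_def split: if_splits)
qed

lemma count_above_eqD:
  assumes "length v = length w" and "\<And>p t. p \<le> length w \<Longrightarrow> count_above v p t = count_above w p t"
  shows "v = w"
proof (rule nth_equalityI)
  fix i assume i: "i < length v"
  have "t < v ! i \<longleftrightarrow> t < w ! i" for t
    using assms(2)[of i t] assms(2)[of "Suc i" t] i assms(1)
    by (simp add: count_above_Suc of_bool_def split: if_splits)
  then show "v ! i = w ! i"
    by (metis linorder_neqE_nat less_irrefl)
qed (fact assms(1))

lemma count_above_decreasing:
  assumes "sorted_wrt (\<ge>) \<alpha>" and "p \<le> length \<alpha>"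
  shows "count_above \<alpha> p t = min p (count_above \<alpha> (length \<alpha>) t)"
proof (cases "\<forall>i<p. t < \<alpha> ! i")
  case True
  then have "count_above \<alpha> p t = p"
    by (simp add: count_above_def)
  moreover have "count_above \<alpha> p t \<le> count_above \<alpha> (length \<alpha>) t"
    unfolding count_above_def using assms(2) by (intro sum_mono2) auto
  ultimately show ?thesis
    by simp
next
  case False
  then obtain i where i: "i < p" "\<alpha> ! i \<le> t"
    by (auto simp: not_less)
  have "\<alpha> ! k \<le> t" if "p \<le> k" "k < length \<alpha>" for k
    using sorted_wrt_nth_less[OF assms(1), of i k] i that by simp
  then have "count_above \<alpha> (length \<alpha>) t = count_above \<alpha> p t"
    unfolding count_above_def using assms(2)
    by (intro sum.mono_neutral_right) (auto simp: not_less)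
  moreover have "count_above \<alpha> p t \<le> (\<Sum>i<p. 1)"
    unfolding count_above_def by (intro sum_mono) simp
  ultimately show ?thesis
    by simp
qed

text \<open>
  The counts of a decreasing composition are as large as the prefix length and the total allow.
\<close>

lemma bruhat_le_decreasing:
  assumes "bruhat_le v \<alpha>" and "sorted_wrt (\<ge>) \<alpha>"
  shows "v = \<alpha>"
proof (rule count_above_eqD)
  show "length v = length \<alpha>"
    by (rule bruhat_leD(1)[OF assms(1)])
  fix p t
  assume p: "p \<le> length \<alpha>"
  have "count_above v p t \<le> (\<Sum>i<p. 1)"
    unfolding count_above_def by (intro sum_mono) simp
  moreover have "count_above v p t \<le> count_above v (length \<alpha>) t"
    unfolding count_above_def using p by (intro sum_mono2) auto
  ultimately show "count_above v p t = count_above \<alpha> p t"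
    using count_above_decreasing[OF assms(2) p] bruhat_leD(2)[OF assms(1), of t]
      bruhat_leD(3)[OF assms(1) p, of t]
    by simp
qed

lemma bruhat_le_bound:
  assumes "bruhat_le v w" and "\<And>x. x \<in> set w \<Longrightarrow> x \<le> N" and "x \<in> set v"
  shows "x \<le> N"
proof -
  have "\<forall>i<length w. w ! i \<le> N"
    using assms(2) by simp
  then have "count_above w (length w) N = 0"
    by (auto simp: count_above_def not_less)
  then have "\<forall>i<length w. v ! i \<le> N"
    using bruhat_leD(2)[OF assms(1), of N] by (fastforce simp: count_above_def)
  with assms(3) bruhat_leD(1)[OF assms(1)] show ?thesis
    by (auto simp: in_set_conv_nth)
qed

lemma bruhat_le_swap:
  assumes "p < q" and "q < length w" and "w ! p \<le> w ! q"
  shows "bruhat_le (w[p := w ! q, q := w ! p]) w"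
proof -
  let ?v = "w[p := w ! q, q := w ! p]"
  have nth: "?v ! p = w ! q" "?v ! q = w ! p" "\<And>i. i \<noteq> p \<Longrightarrow> i \<noteq> q \<Longrightarrow> ?v ! i = w ! i"
    using assms by (auto simp: nth_list_update)
  have split: "count_above u k t = (if p < k then of_bool (t < u ! p) else 0) +
      (if q < k then of_bool (t < u ! q) else 0) + (\<Sum>i\<in>{..<k} - {p, q}. of_bool (t < u ! i))" for u k t
  proof -
    have "count_above u k t = (\<Sum>i\<in>{..<k} - {p, q}. of_bool (t < u ! i)) +
        (\<Sum>i\<in>{..<k} \<inter> {p, q}. of_bool (t < u ! i))"
      unfolding count_above_def by (metis (no_types, lifting) Diff_Int_distrib2 add.commute finite_lessThan sum.Int_Diff)
    moreover have "{..<k} \<inter> {p, q} = (if p < k then {p} else {}) \<union> (if q < k then {q} else {})"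
      by auto
    ultimately show ?thesis
      using assms(1) by auto
  qed
  have rest: "(\<Sum>i\<in>{..<k} - {p, q}. of_bool (t < ?v ! i)) = (\<Sum>i\<in>{..<k} - {p, q}. of_bool (t < w ! i) :: nat)" for k t
    using nth(3) by (intro sum.cong) auto
  show ?thesis
    by (rule bruhat_leI) (use assms in \<open>auto simp: split[of ?v] split[of w] rest nth of_bool_def\<close>)
qed

section \<open>Removing the first column\<close>

definition support :: "nat list \<Rightarrow> nat set" where
  "support v = {i. i < length v \<and> 0 < v ! i}"

text \<open>
  On diagrams this removes the first column: truncated subtraction keeps empty rows empty.
\<close>

definition peel :: "nat list \<Rightarrow> nat list" where
  "peel v = map (\<lambda>x. x - 1) v"

lemma length_peel [simp]: "length (peel v) = length v"
  by (simp add: peel_def)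

lemma nth_peel: "i < length v \<Longrightarrow> peel v ! i = v ! i - 1"
  by (simp add: peel_def)

lemma bruhat_le_peel:
  assumes "bruhat_le v w"
  shows "bruhat_le (peel v) (peel w)"
proof -
  have "count_above (peel u) p t = count_above u p (Suc t)" if "p \<le> length u" for u p t
    unfolding count_above_def using that by (intro sum.cong) (auto simp: nth_peel)
  with assms show ?thesis
    by (simp add: bruhat_le_def)
qed

lemma swap_entries_peel: "Suc i < length v \<Longrightarrow> swap_entries i (peel v) = peel (swap_entries i v)"
  by (simp add: swap_entries_def peel_def map_update)

lemma support_swap_entries:
  assumes "Suc i < length v"
  shows "k \<in> support (swap_entries i v) \<longleftrightarrow> transpose i (Suc i) k \<in> support v"
  using assms by (auto simp: support_def swap_entries_def nth_list_update transpose_def)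

text \<open>
  If \<open>\<alpha>\<close> has an ascent \<open>k\<close> away from \<open>j\<close>, the two operators commute. If the ascent is adjacent
  to \<open>j\<close>, then \<open>key_poly \<alpha>\<close> is \<open>demazure k (demazure j f)\<close> for a key polynomial \<open>f\<close> fixed by
  \<open>demazure k\<close>, by induction, and the braid relation moves the outer \<open>demazure j\<close> past these two
  operators.
\<close>

lemma demazure_key_poly_eq:
  assumes "Suc j < length \<alpha>" and "\<alpha> ! j = \<alpha> ! Suc j"
  shows "demazure j (key_poly \<alpha>) = key_poly \<alpha>"
  using assms
proof (induction "\<Sum>i<length \<alpha>. i * \<alpha> ! i" arbitrary: \<alpha> j rule: less_induct)
  case less
  have IH: "demazure i (key_poly \<beta>) = key_poly \<beta>"
    if "(\<Sum>i<length \<beta>. i * \<beta> ! i) < (\<Sum>i<length \<alpha>. i * \<alpha> ! i)"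
      "Suc i < length \<beta>" "\<beta> ! i = \<beta> ! Suc i" for \<beta> i
    using less.hyps that by blast
  show ?case
  proof (cases "sorted_wrt (\<ge>) \<alpha>")
    case True
    have "swap_exponent j (Poly_Mapping.nth \<alpha>) = Poly_Mapping.nth \<alpha>"
      using less.prems
      by (intro poly_mapping_eqI) (auto simp: lookup_swap_exponent transpose_def nth_default_def)
    then show ?thesis
      by (simp add: key_poly_decreasing[OF True] monomial_eq_single demazure_symmetric swap_vars_single)
  next
    case False
    then obtain k where k: "ascent \<alpha> k"
      by (auto simp: weakly_decreasing_iff_no_ascent)
    let ?\<beta> = "swap_entries k \<alpha>"
    have key: "key_poly \<alpha> = demazure k (key_poly ?\<beta>)"
      by (rule key_poly_ascent[OF k])
    note dec = ascent_decreases[OF k]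
    have "k \<noteq> j"
      using k less.prems by (auto simp: ascent_def)
    then consider "Suc j < k \<or> Suc k < j" | "k = Suc j" | "j = Suc k"
      by linarith
    then show ?thesis
    proof cases
      case 1
      have "demazure j (key_poly ?\<beta>) = key_poly ?\<beta>"
        using 1 dec less.prems by (intro IH) (auto simp: swap_entries_def nth_list_update)
      with 1 key demazure_commute show ?thesis
        by metis
    next
      case 2
      let ?\<gamma> = "swap_entries j ?\<beta>"
      have asc: "ascent ?\<beta> j"
        using 2 k less.prems by (auto simp: ascent_def swap_entries_def nth_list_update)
      have "demazure k (key_poly ?\<gamma>) = key_poly ?\<gamma>"
        using 2 k less.prems dec ascent_decreases[OF asc]
        by (intro IH) (auto simp: ascent_def swap_entries_def nth_list_update)
      with demazure_braid[of j "key_poly ?\<gamma>"]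
      have "demazure j (demazure k (demazure j (key_poly ?\<gamma>))) = demazure k (demazure j (key_poly ?\<gamma>))"
        unfolding 2 by simp
      then show ?thesis
        by (simp only: key key_poly_ascent[OF asc])
    next
      case 3
      let ?\<gamma> = "swap_entries j ?\<beta>"
      have asc: "ascent ?\<beta> j"
        using 3 k less.prems by (auto simp: ascent_def swap_entries_def nth_list_update)
      have "demazure k (key_poly ?\<gamma>) = key_poly ?\<gamma>"
        using 3 k less.prems dec ascent_decreases[OF asc]
        by (intro IH) (auto simp: ascent_def swap_entries_def nth_list_update)
      with demazure_braid[of k "key_poly ?\<gamma>"]
      have "demazure j (demazure k (demazure j (key_poly ?\<gamma>))) = demazure k (demazure j (key_poly ?\<gamma>))"
        unfolding 3 by simp
      then show ?thesis
        by (simp only: key key_poly_ascent[OF asc])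
    qed
  qed
qed

lemma demazure_key_poly_up:
  assumes "Suc j < length \<alpha>" and "\<alpha> ! j \<le> \<alpha> ! Suc j"
  shows "demazure j (key_poly \<alpha>) = key_poly \<alpha>"
proof (cases "\<alpha> ! j = \<alpha> ! Suc j")
  case False
  with assms have "ascent \<alpha> j"
    by (simp add: ascent_def)
  then show ?thesis
    by (simp add: key_poly_ascent[of \<alpha> j] demazure_symmetric)
qed (use assms demazure_key_poly_eq in blast)

lemma demazure_key_poly_down:
  assumes "Suc j < length \<alpha>" and "\<alpha> ! Suc j \<le> \<alpha> ! j"
  shows "demazure j (key_poly \<alpha>) = key_poly (swap_entries j \<alpha>)"
proof (cases "\<alpha> ! j = \<alpha> ! Suc j")
  case True
  then have "swap_entries j \<alpha> = \<alpha>"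
    using assms by (intro nth_equalityI) (auto simp: swap_entries_def nth_list_update)
  with True assms show ?thesis
    by (simp add: demazure_key_poly_up)
next
  case False
  with assms have "ascent (swap_entries j \<alpha>) j"
    by (simp add: ascent_def swap_entries_def)
  then show ?thesis
    using assms by (simp add: key_poly_ascent[of "swap_entries j \<alpha>" j] swap_entries_swap_entries)
qed

definition column_monomial :: "nat set \<Rightarrow> polynomial" where
  "column_monomial C = (\<Prod>i\<in>C. var i)"

lemma swap_vars_column_monomial:
  assumes "finite C"
  shows "swap_vars i (column_monomial C) = column_monomial (transpose i (Suc i) ` C)"
proof -
  have "swap_vars i 1 = 1"
    using swap_vars_single[of i 0 1] by (simp add: swap_exponent_def)
  with assms have "swap_vars i (\<Prod>k\<in>C. var k) = (\<Prod>k\<in>C. var (transpose i (Suc i) k))"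
    by (induction rule: finite_induct) (simp_all add: swap_vars_mult swap_vars_var)
  then show ?thesis
    by (simp add: column_monomial_def prod.reindex)
qed

definition largest_with_support :: "nat list \<Rightarrow> nat set \<Rightarrow> nat list \<Rightarrow> bool" where
  "largest_with_support \<alpha> C M \<longleftrightarrow> bruhat_le M \<alpha> \<and> support M = C \<and>
     (\<forall>v. bruhat_le v \<alpha> \<and> support v = C \<longrightarrow> bruhat_le v M)"

text \<open>
  The polynomial that multiplies the column \<open>C\<close> in the expansion of \<open>key_poly \<alpha>\<close>. It is a
  relation because the existence of the largest rearrangement is established only in the course
  of the induction.
\<close>

definition column_coeff :: "nat list \<Rightarrow> nat set \<Rightarrow> polynomial \<Rightarrow> bool" where
  "column_coeff \<alpha> C f \<longleftrightarrow>
     (\<exists>M. largest_with_support \<alpha> C M \<and> f = key_poly (peel M)) \<or>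
     (\<nexists>v. bruhat_le v \<alpha> \<and> support v = C) \<and> f = 0"

text \<open>
  The rearrangements below \<open>\<alpha>\<close> are those below \<open>swap_entries i \<alpha>\<close> and their images under
  \<open>swap_entries i\<close>.
\<close>

lemma bruhat_le_ascent_step:
  assumes "ascent \<alpha> i"
  shows "bruhat_le v (swap_entries i \<alpha>) \<Longrightarrow> bruhat_le v \<alpha>"
    and "bruhat_le v (swap_entries i \<alpha>) \<Longrightarrow> bruhat_le (swap_entries i v) \<alpha>"
    and "bruhat_le v \<alpha> \<Longrightarrow> v ! Suc i \<le> v ! i \<Longrightarrow> bruhat_le v (swap_entries i \<alpha>)"
    and "bruhat_le v \<alpha> \<Longrightarrow> v ! i \<le> v ! Suc i \<Longrightarrow> bruhat_le (swap_entries i v) (swap_entries i \<alpha>)"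
proof -
  have i: "Suc i < length \<alpha>" "\<alpha> ! i \<le> \<alpha> ! Suc i"
    using assms by (auto simp: ascent_def)
  have down: "bruhat_le (swap_entries i \<alpha>) \<alpha>"
    using bruhat_le_swap_entries_left[OF bruhat_le_refl i] .
  show 1: "bruhat_le v \<alpha>" if "bruhat_le v (swap_entries i \<alpha>)" for v
    using that down by (rule bruhat_le_trans)
  show "bruhat_le (swap_entries i v) \<alpha>" if "bruhat_le v (swap_entries i \<alpha>)"
    using 1[OF that] i by (rule bruhat_le_swap_entries_left)
  show "bruhat_le v (swap_entries i \<alpha>)" if "bruhat_le v \<alpha>" "v ! Suc i \<le> v ! i"
    using that i by (intro bruhat_le_swap_entries_right)
  assume v: "bruhat_le v \<alpha>" "v ! i \<le> v ! Suc i"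
  have len: "Suc i < length v"
    using i bruhat_leD(1)[OF v(1)] by simp
  have "bruhat_le (swap_entries i v) v"
    using bruhat_le_refl len v(2) by (rule bruhat_le_swap_entries_left)
  then have "bruhat_le (swap_entries i v) \<alpha>"
    using v(1) by (rule bruhat_le_trans)
  then show "bruhat_le (swap_entries i v) (swap_entries i \<alpha>)"
    using i len v(2) by (intro bruhat_le_swap_entries_right) (simp_all add: swap_entries_def)
qed

text \<open>
  If \<open>C\<close> is symmetric, then exchanging the entries \<open>i\<close> and \<open>Suc i\<close> maps rearrangements with
  support \<open>C\<close> to such rearrangements, and the largest one becomes the larger of \<open>M\<close> and
  \<open>swap_entries i M\<close>.
\<close>

lemma column_coeff_ascent_both:
  assumes asc: "ascent \<alpha> i" and C: "i \<in> C \<longleftrightarrow> Suc i \<in> C"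
    and f: "column_coeff (swap_entries i \<alpha>) C f"
  shows "column_coeff \<alpha> C (demazure i f)"
proof -
  have i: "Suc i < length \<alpha>"
    using asc by (simp add: ascent_def)
  note step = bruhat_le_ascent_step[OF asc]
  have supp: "support (swap_entries i v) = C" if "support v = C" "Suc i < length v" for v
    using that C by (auto simp: support_swap_entries transpose_def split: if_splits)
  have below: "\<exists>w\<in>{v, swap_entries i v}. bruhat_le w (swap_entries i \<alpha>) \<and> support w = C"
    if "bruhat_le v \<alpha>" "support v = C" for v
    using that step(3,4)[of v] supp[of v] i bruhat_leD(1)[OF that(1)] by (metis insertCI linear)
  from f consider (some) M where "largest_with_support (swap_entries i \<alpha>) C M" "f = key_poly (peel M)"
    | (none) "\<nexists>v. bruhat_le v (swap_entries i \<alpha>) \<and> support v = C" "f = 0"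
    by (auto simp: column_coeff_def)
  then show ?thesis
  proof cases
    case none
    then have "\<nexists>v. bruhat_le v \<alpha> \<and> support v = C"
      using below by blast
    then show ?thesis
      by (simp add: column_coeff_def none(2))
  next
    case some
    have M: "bruhat_le M (swap_entries i \<alpha>)" "support M = C"
      "\<And>v. bruhat_le v (swap_entries i \<alpha>) \<Longrightarrow> support v = C \<Longrightarrow> bruhat_le v M"
      using some(1) by (auto simp: largest_with_support_def)
    have len: "Suc i < length M"
      using bruhat_leD(1)[OF M(1)] i by simp
    define N where "N = (if M ! i \<le> M ! Suc i then M else swap_entries i M)"
    have N_up: "N ! i \<le> N ! Suc i"
      using len by (auto simp: N_def swap_entries_def)
    have lenN: "length N = length M"
      by (simp add: N_def)
    have "bruhat_le M N"
      using len by (auto simp: N_def intro: bruhat_le_swap_entries_right)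
    have "bruhat_le v N" if v: "bruhat_le v \<alpha>" "support v = C" for v
    proof -
      obtain w where w: "w = v \<or> w = swap_entries i v" "bruhat_le w (swap_entries i \<alpha>)" "support w = C"
        using below[OF v] by blast
      then have wN: "bruhat_le w N"
        using M(3) \<open>bruhat_le M N\<close> bruhat_le_trans by blast
      then have "bruhat_le (swap_entries i w) N"
        using len lenN N_up by (intro bruhat_le_swap_entries_left) auto
      with w(1) wN i bruhat_leD(1)[OF v(1)] show ?thesis
        by (auto simp: swap_entries_swap_entries)
    qed
    then have "largest_with_support \<alpha> C N"
      using M step(1,2)[OF M(1)] supp[OF M(2) len] by (auto simp: largest_with_support_def N_def)
    moreover have "demazure i f = key_poly (peel N)"
      using len some(2) demazure_key_poly_up[of i "peel M"] demazure_key_poly_down[of i "peel M"]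
      by (auto simp: N_def nth_peel swap_entries_peel)
    ultimately show ?thesis
      by (auto simp: column_coeff_def)
  qed
qed

text \<open>
  If only \<open>i\<close> belongs to \<open>C\<close>, then the rearrangements with support \<open>C\<close> decrease from \<open>i\<close> to \<open>Suc
  i\<close>, so no new ones appear below \<open>\<alpha>\<close>. Those with the reflected support are exactly their images
  under the exchange.
\<close>

lemma column_coeff_ascent_left:
  assumes asc: "ascent \<alpha> i" and C: "i \<in> C" "Suc i \<notin> C"
    and f: "column_coeff (swap_entries i \<alpha>) C f"
  shows "column_coeff \<alpha> C f" and "column_coeff \<alpha> (transpose i (Suc i) ` C) (demazure i f)"
proof -
  let ?C' = "transpose i (Suc i) ` C"
  have i: "Suc i < length \<alpha>"
    using asc by (simp add: ascent_def)
  note step = bruhat_le_ascent_step[OF asc]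
  have supp: "support (swap_entries i v) = C" if "support v = ?C'" "Suc i < length v" for v
    using that by (auto simp: support_swap_entries) (metis imageI transpose_involutory)
  have supp': "support (swap_entries i v) = ?C'" if "support v = C" "Suc i < length v" for v
    using that by (auto simp: support_swap_entries) (metis imageI transpose_involutory)
  have zero: "v ! Suc i = 0" if "support v = C" "Suc i < length v" for v
    using that C(2) by (auto simp: support_def)
  have zero': "v ! i = 0" if "support v = ?C'" "Suc i < length v" for v
  proof -
    have "i \<notin> ?C'"
      using C by (auto simp: transpose_def split: if_splits)
    with that show ?thesis
      by (auto simp: support_def)
  qed
  have below: "bruhat_le v (swap_entries i \<alpha>)" if "bruhat_le v \<alpha>" "support v = C" for v
    using step(3)[OF that(1)] zero[OF that(2)] bruhat_leD(1)[OF that(1)] i by simp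
  have below': "bruhat_le (swap_entries i v) (swap_entries i \<alpha>)" "support (swap_entries i v) = C"
    if "bruhat_le v \<alpha>" "support v = ?C'" for v
    using step(4)[OF that(1)] zero'[OF that(2)] supp[OF that(2)] bruhat_leD(1)[OF that(1)] i by simp_all
  from f consider (some) M where "largest_with_support (swap_entries i \<alpha>) C M" "f = key_poly (peel M)"
    | (none) "\<nexists>v. bruhat_le v (swap_entries i \<alpha>) \<and> support v = C" "f = 0"
    by (auto simp: column_coeff_def)
  then have "column_coeff \<alpha> C f \<and> column_coeff \<alpha> ?C' (demazure i f)"
  proof cases
    case none
    then show ?thesis
      using below below' by (auto simp: column_coeff_def)
  next
    case some
    have M: "bruhat_le M (swap_entries i \<alpha>)" "support M = C"
      "\<And>v. bruhat_le v (swap_entries i \<alpha>) \<Longrightarrow> support v = C \<Longrightarrow> bruhat_le v M"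
      using some(1) by (auto simp: largest_with_support_def)
    have len: "Suc i < length M"
      using bruhat_leD(1)[OF M(1)] i by simp
    let ?N = "swap_entries i M"
    have "bruhat_le M ?N"
      using len zero[OF M(2)] by (intro bruhat_le_swap_entries_right) auto
    have "bruhat_le v ?N" if v: "bruhat_le v \<alpha>" "support v = ?C'" for v
    proof -
      have "bruhat_le (swap_entries i v) ?N"
        using M(3)[OF below'[OF v]] \<open>bruhat_le M ?N\<close> by (rule bruhat_le_trans)
      then have "bruhat_le (swap_entries i (swap_entries i v)) ?N"
        by (rule bruhat_le_swap_entries_left) (use len zero[OF M(2)] in \<open>simp_all add: swap_entries_def\<close>)
      with i bruhat_leD(1)[OF v(1)] show ?thesis
        by (simp add: swap_entries_swap_entries)
    qed
    then have "largest_with_support \<alpha> ?C' ?N"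
      using step(2)[OF M(1)] supp'[OF M(2) len] by (auto simp: largest_with_support_def)
    moreover have "demazure i f = key_poly (peel ?N)"
      using len some(2) demazure_key_poly_down[of i "peel M"] zero[OF M(2)]
      by (auto simp: nth_peel swap_entries_peel)
    moreover have "largest_with_support \<alpha> C M"
      using M below step(1)[OF M(1)] by (auto simp: largest_with_support_def)
    ultimately show ?thesis
      using some(2) by (auto simp: column_coeff_def)
  qed
  then show "column_coeff \<alpha> C f" and "column_coeff \<alpha> ?C' (demazure i f)"
    by auto
qed

text \<open>
  The entry at \<open>i\<close> is 0, so there is no descent from \<open>i\<close> to \<open>Suc i\<close>, and the key polynomial is
  symmetric.
\<close>

lemma column_coeff_symmetric:
  assumes "column_coeff \<alpha> C f" and "Suc i < length \<alpha>" and "i \<notin> C"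
  shows "swap_vars i f = f"
proof -
  have "swap_vars i (key_poly (peel M)) = key_poly (peel M)" if "bruhat_le M \<alpha>" "support M = C" for M
  proof -
    have "demazure i (key_poly (peel M)) = key_poly (peel M)"
      using assms that bruhat_leD(1)[OF that(1)]
      by (intro demazure_key_poly_up) (auto simp: support_def nth_peel)
    then show ?thesis
      by (metis swap_vars_demazure)
  qed
  with assms(1) show ?thesis
    by (auto simp: column_coeff_def largest_with_support_def)
qed

text \<open>
  Induction along an ascent \<open>i\<close>: applying \<open>demazure i\<close> to the expansion for \<open>swap_entries i \<alpha>\<close>
  gives the expansion for \<open>\<alpha>\<close>. Columns containing both or none of \<open>i\<close>, \<open>Suc i\<close> are symmetric
  factors. A column containing only \<open>i\<close> produces two columns, itself and its reflection, by
  \<open>demazure i (var i * f) = var i * f + var (Suc i) * demazure i f\<close>. A column containing only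
  \<open>Suc i\<close> has a symmetric coefficient and is killed. By \<open>column_coeff_ascent_both\<close> and
  \<open>column_coeff_ascent_left\<close> the resulting coefficients are those that the largest
  rearrangements below \<open>\<alpha>\<close> prescribe.
\<close>

theorem key_poly_column_expansion:
  "\<exists>F. key_poly \<alpha> = (\<Sum>C\<in>Pow {..<length \<alpha>}. column_monomial C * F C) \<and>
     (\<forall>C\<in>Pow {..<length \<alpha>}. column_coeff \<alpha> C (F C))"
proof (induction \<alpha> rule: key_poly_induct)
  case (decreasing \<alpha>)
  have supp: "support \<alpha> \<in> Pow {..<length \<alpha>}"
    by (auto simp: support_def)
  define F where "F C = (if C = support \<alpha> then key_poly (peel \<alpha>) else 0)" for C
  have "largest_with_support \<alpha> (support \<alpha>) \<alpha>"
    by (simp add: largest_with_support_def)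
  then have "column_coeff \<alpha> C (F C)" for C
    using bruhat_le_decreasing[OF _ decreasing] by (auto simp: column_coeff_def F_def)
  moreover have "key_poly \<alpha> = column_monomial (support \<alpha>) * key_poly (peel \<alpha>)"
  proof -
    have "sorted_wrt (\<ge>) (peel \<alpha>)"
      using decreasing unfolding peel_def sorted_wrt_map
      by (rule sorted_wrt_mono_rel[rotated]) simp
    moreover have "monomial \<alpha> = column_monomial (support \<alpha>) * monomial (peel \<alpha>)"
    proof -
      have "column_monomial (support \<alpha>) = (\<Prod>i<length \<alpha>. if 0 < \<alpha> ! i then var i else 1)"
        unfolding column_monomial_def support_def
        by (simp add: prod.If_cases Int_def)
      then have "column_monomial (support \<alpha>) * monomial (peel \<alpha>) =
          (\<Prod>i<length \<alpha>. (if 0 < \<alpha> ! i then var i else 1) * var i ^ (\<alpha> ! i - 1))"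
        by (simp add: monomial_def prod.distrib nth_peel)
      also have "\<dots> = monomial \<alpha>"
        unfolding monomial_def by (intro prod.cong) (auto simp flip: power_Suc)
      finally show ?thesis ..
    qed
    ultimately show ?thesis
      by (simp add: key_poly_decreasing decreasing)
  qed
  then have "key_poly \<alpha> = (\<Sum>C\<in>Pow {..<length \<alpha>}. column_monomial C * F C)"
    using supp by (simp add: F_def if_distrib[of "\<lambda>f. _ * f"] sum.delta cong: if_cong)
  ultimately show ?case
    by blast
next
  case (ascent \<alpha> i)
  let ?P = "Pow {..<length \<alpha>}" and ?s = "\<lambda>C. transpose i (Suc i) ` C"
  have i: "Suc i < length \<alpha>"
    using ascent(1) by (simp add: ascent_def)
  from ascent.IH obtain F where
    key: "key_poly (swap_entries i \<alpha>) = (\<Sum>C\<in>?P. column_monomial C * F C)"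
    and F: "\<And>C. C \<in> ?P \<Longrightarrow> column_coeff (swap_entries i \<alpha>) C (F C)"
    by auto
  define A where "A = {C \<in> ?P. i \<in> C \<longleftrightarrow> Suc i \<in> C}"
  define L where "L = {C \<in> ?P. i \<in> C \<and> Suc i \<notin> C}"
  define R where "R = {C \<in> ?P. i \<notin> C \<and> Suc i \<in> C}"
  have P: "?P = A \<union> L \<union> R" and disj: "A \<inter> L = {}" "(A \<union> L) \<inter> R = {}"
    and fin: "finite A" "finite L" "finite R"
    by (auto simp: A_def L_def R_def)
  have sum_split: "sum g ?P = sum g A + sum g L + sum g R" for g :: "nat set \<Rightarrow> polynomial"
    unfolding P using disj fin by (simp add: sum.union_disjoint)
  have s_s: "?s (?s C) = C" for C
    by (simp add: image_image)
  have s_P: "?s C \<in> ?P" if "C \<in> ?P" for C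
    using that i by (auto simp: transpose_def)
  have s_mem: "i \<in> ?s C \<longleftrightarrow> Suc i \<in> C" "Suc i \<in> ?s C \<longleftrightarrow> i \<in> C" for C
    by (auto simp: transpose_def image_iff)
  have s_L: "?s C \<in> R" if "C \<in> L" for C
    using that s_P s_mem by (simp add: L_def R_def)
  have s_R: "?s C \<in> L" if "C \<in> R" for C
    using that s_P s_mem by (simp add: L_def R_def)
  define G where "G C = (if C \<in> L then F C else if C \<in> R then demazure i (F (?s C)) else demazure i (F C))" for C
  have finC: "finite C" if "C \<in> ?P" for C
    using that finite_subset by auto
  have swap_X: "swap_vars i (column_monomial C) = column_monomial C" if "i \<in> C \<longleftrightarrow> Suc i \<in> C" "finite C" for C
    using swap_vars_column_monomial[OF that(2), of i] that(1) by simp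
  have sum_A: "(\<Sum>C\<in>A. demazure i (column_monomial C * F C)) = (\<Sum>C\<in>A. column_monomial C * G C)"
  proof (rule sum.cong)
    fix C assume C: "C \<in> A"
    then have "G C = demazure i (F C)"
      by (auto simp: G_def A_def L_def R_def)
    with C show "demazure i (column_monomial C * F C) = column_monomial C * G C"
      using swap_X finC by (simp add: demazure_mult_symmetric A_def)
  qed simp
  have sum_L: "(\<Sum>C\<in>L. demazure i (column_monomial C * F C)) =
      (\<Sum>C\<in>L. column_monomial C * G C) + (\<Sum>C\<in>R. column_monomial C * G C)"
  proof -
    have "(\<Sum>C\<in>R. column_monomial C * G C) = (\<Sum>C\<in>L. column_monomial (?s C) * G (?s C))"
      by (rule sum.reindex_bij_witness[of _ ?s ?s]) (auto simp: s_s s_L s_R)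
    moreover have "demazure i (column_monomial C * F C) =
        column_monomial C * G C + column_monomial (?s C) * G (?s C)" if C: "C \<in> L" for C
    proof -
      define D where "D = C - {i}"
      have D: "i \<notin> D" "Suc i \<notin> D" "finite D" "C = insert i D" "?s C = insert (Suc i) D"
        using C finC by (auto simp: D_def L_def transpose_def image_iff split: if_splits)
      have X: "column_monomial C = var i * column_monomial D"
        "column_monomial (?s C) = var (Suc i) * column_monomial D"
        unfolding D(4,5) by (simp_all add: column_monomial_def D)
      have "demazure i (column_monomial C * F C) = demazure i (column_monomial D * (var i * F C))"
        unfolding X by (simp only: mult_ac)
      also have "\<dots> = column_monomial D * (var i * F C + var (Suc i) * demazure i (F C))"
        using D swap_X[of D] by (simp add: demazure_mult_symmetric demazure_var_mult)
      also have "\<dots> = column_monomial C * F C + column_monomial (?s C) * demazure i (F C)"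
        unfolding X by (simp add: algebra_simps)
      moreover have "G (?s C) = demazure i (F C)"
        using s_L[OF C] by (auto simp: G_def s_s L_def R_def)
      ultimately show ?thesis
        using C by (simp add: G_def)
    qed
    ultimately show ?thesis
      by (simp add: sum.distrib)
  qed
  have sum_R: "demazure i (column_monomial C * F C) = 0" if C: "C \<in> R" for C
  proof -
    define D where "D = C - {Suc i}"
    have D: "i \<notin> D" "Suc i \<notin> D" "finite D" "C = insert (Suc i) D"
      using C finC by (auto simp: D_def R_def)
    have X: "column_monomial C * F C = column_monomial D * (var (Suc i) * F C)"
      unfolding D(4) by (simp add: column_monomial_def D mult_ac)
    have "swap_vars i (F C) = F C"
      using C F[of C] i by (intro column_coeff_symmetric[of "swap_entries i \<alpha>" C]) (auto simp: R_def)
    then show ?thesis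
      unfolding X using D(1-3) swap_X[of D]
      by (simp add: demazure_mult_symmetric demazure_var_Suc_mult_symmetric)
  qed
  have "key_poly \<alpha> = (\<Sum>C\<in>?P. demazure i (column_monomial C * F C))"
    by (simp add: key_poly_ascent[OF ascent(1)] key demazure_sum)
  also have "\<dots> = (\<Sum>C\<in>?P. column_monomial C * G C)"
    unfolding sum_split sum_A sum_L using sum_R by simp
  finally have "key_poly \<alpha> = (\<Sum>C\<in>?P. column_monomial C * G C)" .
  moreover have "column_coeff \<alpha> C (G C)" if C: "C \<in> ?P" for C
  proof -
    consider "C \<in> A" | "C \<in> L" | "C \<in> R"
      using C P by blast
    then show ?thesis
    proof cases
      case 1
      then have "G C = demazure i (F C)"
        by (auto simp: G_def A_def L_def R_def)
      with 1 F[OF C] show ?thesis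
        by (simp add: A_def column_coeff_ascent_both[OF ascent(1)])
    next
      case 2
      with F[OF C] show ?thesis
        by (simp add: L_def G_def column_coeff_ascent_left(1)[OF ascent(1)])
    next
      case 3
      then have "?s C \<in> L"
        by (rule s_R)
      with F[of "?s C"] have "column_coeff \<alpha> (?s (?s C)) (demazure i (F (?s C)))"
        by (intro column_coeff_ascent_left(2)[OF ascent(1)]) (auto simp: L_def)
      with 3 show ?thesis
        unfolding s_s by (auto simp: G_def L_def R_def)
    qed
  qed
  ultimately show ?case
    by blast
qed

section \<open>Monotonicity along the Bruhat order\<close>

lemma lookup_single_mult_add: "lookup (single a 1 * f) (a + m) = lookup f m"
  for a m :: exponent and f :: polynomial
proof (induction f rule: poly_mapping_single_induct)
  case (single_add b c f)
  then show ?case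
    by (simp add: distrib_left lookup_add mult_single lookup_single when_def)
qed simp

lemma lookup_mult_nonneg:
  fixes f g :: polynomial
  assumes "\<And>m. 0 \<le> lookup f m" and "\<And>m. 0 \<le> lookup g m"
  shows "0 \<le> lookup (f * g) m"
proof -
  have "lookup (f * g) m =
      (\<Sum>a\<in>keys f. \<Sum>b\<in>keys g. lookup f a * lookup g b when a + b = m)"
    unfolding mult_eq_sum_keys[of f g] by (simp add: lookup_sum lookup_single)
  also have "\<dots> \<ge> 0"
    using assms by (intro sum_nonneg) (simp add: when_def)
  finally show ?thesis .
qed

definition column_exponent :: "nat set \<Rightarrow> exponent" where
  "column_exponent C = (\<Sum>i\<in>C. single i 1)"

lemma lookup_column_exponent: "finite C \<Longrightarrow> lookup (column_exponent C) i = of_bool (i \<in> C)"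
  by (simp add: column_exponent_def lookup_sum lookup_single when_def of_bool_def)

lemma column_monomial_eq_single: "finite C \<Longrightarrow> column_monomial C = single (column_exponent C) 1"
  unfolding column_monomial_def column_exponent_def
  by (induction rule: finite_induct) (simp_all add: var_def mult_single)

lemma lookup_column_monomial_mono:
  assumes "finite C" and "\<And>m. lookup f m \<le> lookup g m"
  shows "lookup (column_monomial C * f) m \<le> lookup (column_monomial C * g) m"
proof -
  have "0 \<le> lookup (column_monomial C * (g - f)) m"
    using assms by (intro lookup_mult_nonneg)
      (auto simp: column_monomial_eq_single lookup_single lookup_minus when_def)
  then show ?thesis
    by (simp add: right_diff_distrib lookup_minus)
qed

lemma support_subset: "support v \<in> Pow {..<length v}"
  by (auto simp: support_def)

text \<open>
  Compare the two expansions column by column. Every column of \<open>v\<close> is a column of \<open>\<alpha>\<close>, and the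
  largest rearrangement below \<open>v\<close> with a given support is below the one for \<open>\<alpha>\<close>. Removing the
  column lowers the largest entry, so induction applies to the coefficients.
\<close>

theorem key_poly_mono:
  assumes "bruhat_le v \<alpha>"
  shows "0 \<le> lookup (key_poly v) m \<and> lookup (key_poly v) m \<le> lookup (key_poly \<alpha>) m"
proof -
  have "0 \<le> lookup (key_poly v) m \<and> lookup (key_poly v) m \<le> lookup (key_poly \<alpha>) m"
    if "bruhat_le v \<alpha>" "\<And>x. x \<in> set \<alpha> \<Longrightarrow> x \<le> N" for N
    using that
  proof (induction N arbitrary: v \<alpha> m)
    case 0
    have "\<alpha> ! i = 0" if "i < length \<alpha>" for i
      using 0(2)[OF nth_mem[OF that]] by simp
    then have dec: "sorted_wrt (\<ge>) \<alpha>"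
      by (auto simp: sorted_wrt_iff_nth_less)
    with 0(1) have "v = \<alpha>"
      by (rule bruhat_le_decreasing)
    with dec show ?case
      by (simp add: key_poly_decreasing monomial_eq_single lookup_single when_def)
  next
    case (Suc N)
    let ?P = "Pow {..<length \<alpha>}"
    have len: "length v = length \<alpha>"
      by (rule bruhat_leD(1)[OF Suc.prems(1)])
    obtain F where F: "key_poly v = (\<Sum>C\<in>?P. column_monomial C * F C)"
      "\<And>C. C \<in> ?P \<Longrightarrow> column_coeff v C (F C)"
      using key_poly_column_expansion[of v] unfolding len by blast
    obtain G where G: "key_poly \<alpha> = (\<Sum>C\<in>?P. column_monomial C * G C)"
      "\<And>C. C \<in> ?P \<Longrightarrow> column_coeff \<alpha> C (G C)"
      using key_poly_column_expansion[of \<alpha>] by blast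
    have IH: "0 \<le> lookup (key_poly (peel u)) m \<and> lookup (key_poly (peel u)) m \<le> lookup (key_poly (peel w)) m"
      if "bruhat_le u w" "bruhat_le w \<alpha>" for u w m
    proof (rule Suc.IH)
      show "bruhat_le (peel u) (peel w)"
        using that(1) by (rule bruhat_le_peel)
      fix x
      assume "x \<in> set (peel w)"
      then show "x \<le> N"
        using bruhat_le_bound[OF that(2) Suc.prems(2)] by (fastforce simp: peel_def)
    qed
    have FG: "0 \<le> lookup (F C) m \<and> lookup (F C) m \<le> lookup (G C) m" if C: "C \<in> ?P" for C m
    proof -
      have G_nonneg: "0 \<le> lookup (G C) m"
        using G(2)[OF C] IH[OF bruhat_le_refl] by (auto simp: column_coeff_def largest_with_support_def)
      from F(2)[OF C] consider
        (some) M where "largest_with_support v C M" "F C = key_poly (peel M)" | (none) "F C = 0"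
        by (auto simp: column_coeff_def)
      then show ?thesis
      proof cases
        case some
        then have M: "bruhat_le M \<alpha>" "support M = C"
          using bruhat_le_trans[OF _ Suc.prems(1)] by (auto simp: largest_with_support_def)
        then obtain N where N: "largest_with_support \<alpha> C N" "G C = key_poly (peel N)"
          using G(2)[OF C] by (auto simp: column_coeff_def)
        then have "bruhat_le M N" "bruhat_le N \<alpha>"
          using M by (auto simp: largest_with_support_def)
        then show ?thesis
          unfolding some(2) N(2) by (rule IH)
      qed (use G_nonneg in simp)
    qed
    have fin: "finite C" if "C \<in> ?P" for C
      using that finite_subset by auto
    have "lookup (key_poly v) m \<le> lookup (key_poly \<alpha>) m"
      unfolding F(1) G(1) lookup_sum
      using fin FG by (intro sum_mono lookup_column_monomial_mono) auto
    moreover have "0 \<le> lookup (key_poly v) m"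
      unfolding F(1) lookup_sum
    proof (intro sum_nonneg)
      fix C assume C: "C \<in> ?P"
      then show "0 \<le> lookup (column_monomial C * F C) m"
        using lookup_column_monomial_mono[OF fin[OF C], of 0 "F C" m] FG[OF C] by simp
    qed
    ultimately show ?case
      by blast
  qed
  then show ?thesis
    using assms by (meson Max_ge finite_set)
qed

text \<open>
  Different supports contribute different terms to the column expansion, all of them
  nonnegative. By monotonicity any rearrangement may take the place of the largest one in a
  lower bound.
\<close>

lemma sum_columns_le_key_poly:
  assumes "finite V" and V: "\<And>v. v \<in> V \<Longrightarrow> bruhat_le v \<alpha>" and inj: "inj_on support V"
    and m: "\<And>v. v \<in> V \<Longrightarrow> m = column_exponent (support v) + r v"
  shows "(\<Sum>v\<in>V. lookup (key_poly (peel v)) (r v)) \<le> lookup (key_poly \<alpha>) m"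
proof -
  let ?P = "Pow {..<length \<alpha>}"
  obtain F where F: "key_poly \<alpha> = (\<Sum>C\<in>?P. column_monomial C * F C)"
    "\<And>C. C \<in> ?P \<Longrightarrow> column_coeff \<alpha> C (F C)"
    using key_poly_column_expansion[of \<alpha>] by blast
  have fin: "finite C" if "C \<in> ?P" for C
    using that finite_subset by auto
  have F_nonneg: "0 \<le> lookup (F C) m" if "C \<in> ?P" for C m
    using F(2)[OF that] key_poly_mono[OF bruhat_le_refl] by (auto simp: column_coeff_def)
  have nonneg: "0 \<le> lookup (column_monomial C * F C) m" if "C \<in> ?P" for C
    using lookup_column_monomial_mono[OF fin[OF that], of 0 "F C" m] F_nonneg[OF that] by simp
  have sub: "support ` V \<subseteq> ?P"
  proof (rule image_subsetI)
    fix v assume "v \<in> V"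
    then show "support v \<in> ?P"
      using support_subset[of v] bruhat_leD(1)[OF V] by simp
  qed
  have "lookup (key_poly (peel v)) (r v) \<le> lookup (column_monomial (support v) * F (support v)) m"
    if v: "v \<in> V" for v
  proof -
    have C: "support v \<in> ?P"
      using v sub by blast
    from F(2)[OF C] V[OF v] obtain M where "largest_with_support \<alpha> (support v) M"
      "F (support v) = key_poly (peel M)"
      by (auto simp: column_coeff_def)
    then have "lookup (key_poly (peel v)) (r v) \<le> lookup (F (support v)) (r v)"
      using V[OF v] key_poly_mono[OF bruhat_le_peel, of v M] by (simp add: largest_with_support_def)
    also have "\<dots> = lookup (column_monomial (support v) * F (support v)) m"
      using fin[OF C] by (simp add: m[OF v] column_monomial_eq_single lookup_single_mult_add)
    finally show ?thesis .
  qed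
  then have "(\<Sum>v\<in>V. lookup (key_poly (peel v)) (r v)) \<le>
      (\<Sum>v\<in>V. lookup (column_monomial (support v) * F (support v)) m)"
    by (rule sum_mono)
  also have "\<dots> = (\<Sum>C\<in>support ` V. lookup (column_monomial C * F C) m)"
    by (simp add: sum.reindex[OF inj])
  also have "\<dots> \<le> (\<Sum>C\<in>?P. lookup (column_monomial C * F C) m)"
    using sub nonneg by (intro sum_mono2) auto
  also have "\<dots> = lookup (key_poly \<alpha>) m"
    by (simp add: F(1) lookup_sum)
  finally show ?thesis .
qed

lemma column_le_key_poly:
  assumes "bruhat_le v \<alpha>"
  shows "lookup (key_poly (peel v)) r \<le> lookup (key_poly \<alpha>) (column_exponent (support v) + r)"
  using sum_columns_le_key_poly[of "{v}" \<alpha> _ "\<lambda>_. r"] assms by simp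

lemma two_columns_le_key_poly:
  assumes "bruhat_le v \<alpha>" and "bruhat_le w \<alpha>" and "support v \<noteq> support w"
    and "column_exponent (support v) + r = column_exponent (support w) + s"
  shows "lookup (key_poly (peel v)) r + lookup (key_poly (peel w)) s \<le>
    lookup (key_poly \<alpha>) (column_exponent (support v) + r)"
proof -
  have "v \<noteq> w"
    using assms(3) by blast
  have "(\<Sum>u\<in>{v, w}. lookup (key_poly (peel u)) (if u = v then r else s)) \<le>
      lookup (key_poly \<alpha>) (column_exponent (support v) + r)"
    by (rule sum_columns_le_key_poly) (use assms in auto)
  with \<open>v \<noteq> w\<close> show ?thesis
    by simp
qed

section \<open>Patterns force multiplicities\<close>

lemma finite_support [simp]: "finite (support v)"
  by (simp add: support_def)

lemma column_exponent_support_add_peel: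
  "column_exponent (support v) + Poly_Mapping.nth (peel v) = Poly_Mapping.nth v"
  by (rule poly_mapping_eqI)
    (auto simp: lookup_add lookup_column_exponent support_def nth_default_def nth_peel)

text \<open>
  Taking \<open>\<alpha>\<close> itself in every step of the column expansion gives the monomial of \<open>\<alpha>\<close>.
\<close>

lemma key_poly_leading: "1 \<le> lookup (key_poly \<alpha>) (Poly_Mapping.nth \<alpha>)"
proof -
  have "1 \<le> lookup (key_poly \<alpha>) (Poly_Mapping.nth \<alpha>)" if "\<And>x. x \<in> set \<alpha> \<Longrightarrow> x \<le> N" for N
    using that
  proof (induction N arbitrary: \<alpha>)
    case 0
    have "\<alpha> ! i = 0" if "i < length \<alpha>" for i
      using 0[OF nth_mem[OF that]] by simp
    then have "sorted_wrt (\<ge>) \<alpha>"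
      by (auto simp: sorted_wrt_iff_nth_less)
    then show ?case
      by (simp add: key_poly_decreasing monomial_eq_single)
  next
    case (Suc N)
    have "1 \<le> lookup (key_poly (peel \<alpha>)) (Poly_Mapping.nth (peel \<alpha>))"
      using Suc.prems by (intro Suc.IH) (fastforce simp: peel_def)
    then show ?case
      using column_le_key_poly[OF bruhat_le_refl, of \<alpha> "Poly_Mapping.nth (peel \<alpha>)"]
      by (simp add: column_exponent_support_add_peel)
  qed
  then show ?thesis
    by (meson Max_ge finite_set)
qed

lemma key_poly_bruhat_coeff: "bruhat_le v \<alpha> \<Longrightarrow> 1 \<le> lookup (key_poly \<alpha>) (Poly_Mapping.nth v)"
  using key_poly_leading[of v] key_poly_mono[of v \<alpha>] by (meson order_trans)

definition move_box :: "nat list \<Rightarrow> nat \<Rightarrow> nat \<Rightarrow> nat list" where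
  "move_box v p q = v[p := Suc (v ! p), q := v ! q - 1]"

text \<open>
  Keep the composition for all columns but the last one of row \<open>q\<close>, and exchange the entries \<open>p\<close>
  and \<open>q\<close> for this column only. The induction removes the earlier columns one by one.
\<close>

lemma key_poly_move_box:
  assumes "p < q" and "q < length \<alpha>" and "\<alpha> ! p < \<alpha> ! q"
  shows "1 \<le> lookup (key_poly \<alpha>) (Poly_Mapping.nth (move_box \<alpha> p q))"
  using assms
proof (induction "\<alpha> ! q" arbitrary: \<alpha> rule: less_induct)
  case less
  show ?case
  proof (cases "\<alpha> ! q = Suc (\<alpha> ! p)")
    case True
    then have "move_box \<alpha> p q = \<alpha>[p := \<alpha> ! q, q := \<alpha> ! p]"
      by (simp add: move_box_def)
    with less.prems show ?thesis
      by (simp add: key_poly_bruhat_coeff bruhat_le_swap)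
  next
    case False
    have "1 \<le> lookup (key_poly (peel \<alpha>)) (Poly_Mapping.nth (move_box (peel \<alpha>) p q))"
      using less.prems False by (intro less.hyps) (auto simp: nth_peel)
    also have "\<dots> \<le> lookup (key_poly \<alpha>)
        (column_exponent (support \<alpha>) + Poly_Mapping.nth (move_box (peel \<alpha>) p q))"
      by (intro column_le_key_poly) simp
    also have "column_exponent (support \<alpha>) + Poly_Mapping.nth (move_box (peel \<alpha>) p q) =
        Poly_Mapping.nth (move_box \<alpha> p q)"
      using less.prems False
      by (intro poly_mapping_eqI)
        (auto simp: lookup_add lookup_column_exponent support_def nth_default_def nth_peel
          move_box_def nth_list_update)
    finally show ?thesis .
  qed
qed

text \<open>
  Raising row \<open>p\<close> by one and lowering row \<open>r\<close> by one can be done in two ways: either directly,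
  by moving a box from \<open>r\<close> to \<open>p\<close> in a later column, or by replacing \<open>q\<close> by \<open>p\<close> in the first
  column and moving a box from \<open>r\<close> to \<open>q\<close> afterwards. For the values \<open>(0,1,2)\<close> these are the two
  terms \<open>x_1 x_2 x_3\<close>.
\<close>

lemma multiplicity_012:
  assumes "p < q" "q < r" "r < length \<alpha>" and "\<alpha> ! p = 0" "\<alpha> ! q = 1" "2 \<le> \<alpha> ! r"
  shows "\<exists>m. 2 \<le> lookup (key_poly \<alpha>) m"
proof -
  let ?w = "\<alpha>[p := \<alpha> ! q, q := \<alpha> ! p]"
  let ?m = "Poly_Mapping.nth (move_box (peel \<alpha>) p r)"
    and ?m' = "Poly_Mapping.nth (move_box (peel ?w) q r)"
  have w: "bruhat_le ?w \<alpha>"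
    using assms by (intro bruhat_le_swap) auto
  have "p \<notin> support \<alpha>" "p \<in> support ?w"
    using assms by (auto simp: support_def nth_list_update)
  then have "support \<alpha> \<noteq> support ?w"
    by blast
  moreover have "column_exponent (support \<alpha>) + ?m = column_exponent (support ?w) + ?m'"
    using assms
    by (intro poly_mapping_eqI)
      (auto simp: lookup_add lookup_column_exponent support_def nth_default_def nth_peel
        move_box_def nth_list_update)
  ultimately have "lookup (key_poly (peel \<alpha>)) ?m + lookup (key_poly (peel ?w)) ?m' \<le>
      lookup (key_poly \<alpha>) (column_exponent (support \<alpha>) + ?m)"
    by (rule two_columns_le_key_poly[OF bruhat_le_refl w])
  moreover have "1 \<le> lookup (key_poly (peel \<alpha>)) ?m" "1 \<le> lookup (key_poly (peel ?w)) ?m'"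
    using assms by (auto intro!: key_poly_move_box simp: nth_peel nth_list_update)
  ultimately show ?thesis
    by (intro exI[of _ "column_exponent (support \<alpha>) + ?m"]) linarith
qed

text \<open>
  In rows \<open>q, r, s\<close> the first column consists of \<open>r, s\<close> or of \<open>q, s\<close>; the second column then
  consists of \<open>p, q\<close> or of \<open>p, r\<close>, respectively. Either way rows \<open>p\<close> and \<open>q\<close> gain a box and rows
  \<open>r\<close> and \<open>s\<close> lose one. This covers the patterns \<open>(1,0,2,2)\<close> and \<open>(0,0,2,2)\<close>.
\<close>

lemma multiplicity_1022:
  assumes "p < q" "q < r" "r < s" "s < length \<alpha>"
    and "\<alpha> ! p \<le> 1" "\<alpha> ! q = 0" "\<alpha> ! r = 2" "\<alpha> ! s = 2"
  shows "\<exists>m. 2 \<le> lookup (key_poly \<alpha>) m"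
proof -
  let ?w = "\<alpha>[q := \<alpha> ! r, r := \<alpha> ! q]"
  let ?a = "peel \<alpha>" and ?b = "peel ?w"
  \<comment> \<open>The second columns \<open>p, q\<close> and \<open>p, r\<close> are reached by two exchanges each.\<close>
  let ?u1 = "?a[p := ?a ! r, r := ?a ! p]" and ?v1 = "?b[p := ?b ! q, q := ?b ! p]"
  let ?u = "?u1[q := ?u1 ! s, s := ?u1 ! q]" and ?v = "?v1[r := ?v1 ! s, s := ?v1 ! r]"
  have w: "bruhat_le ?w \<alpha>"
    using assms by (intro bruhat_le_swap) auto
  have "bruhat_le ?u ?u1"
    using assms by (intro bruhat_le_swap) (auto simp: nth_peel nth_list_update)
  moreover have "bruhat_le ?u1 ?a"
    using assms by (intro bruhat_le_swap) (auto simp: nth_peel nth_list_update)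
  moreover have "bruhat_le ?v ?v1"
    using assms by (intro bruhat_le_swap) (auto simp: nth_peel nth_list_update)
  moreover have "bruhat_le ?v1 ?b"
    using assms by (intro bruhat_le_swap) (auto simp: nth_peel nth_list_update)
  ultimately have u: "bruhat_le ?u ?a" and v: "bruhat_le ?v ?b"
    by (blast intro: bruhat_le_trans)+
  have "q \<notin> support \<alpha>" "q \<in> support ?w"
    using assms by (auto simp: support_def nth_list_update)
  then have "support \<alpha> \<noteq> support ?w"
    by blast
  moreover have "column_exponent (support \<alpha>) + Poly_Mapping.nth ?u =
      column_exponent (support ?w) + Poly_Mapping.nth ?v"
    using assms
    by (intro poly_mapping_eqI)
      (auto simp: lookup_add lookup_column_exponent support_def nth_default_def nth_peel nth_list_update)
  ultimately have "lookup (key_poly ?a) (Poly_Mapping.nth ?u) + lookup (key_poly ?b) (Poly_Mapping.nth ?v) \<le>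
      lookup (key_poly \<alpha>) (column_exponent (support \<alpha>) + Poly_Mapping.nth ?u)"
    by (rule two_columns_le_key_poly[OF bruhat_le_refl w])
  with key_poly_bruhat_coeff[OF u] key_poly_bruhat_coeff[OF v] show ?thesis
    by (intro exI[of _ "column_exponent (support \<alpha>) + Poly_Mapping.nth ?u"]) linarith
qed

text \<open>
  The box of row \<open>s\<close> in the first column moves to row \<open>p\<close> or \<open>q\<close>, and a later box of row \<open>r\<close>
  moves to the other of these two rows. This covers the patterns \<open>(0,0,2,1)\<close> and, once the
  columns up to the second smallest value have been removed, \<open>(1,0,3,2)\<close>.
\<close>

lemma multiplicity_0021:
  assumes "p < q" "q < r" "r < s" "s < length \<alpha>"
    and "\<alpha> ! p = 0" "\<alpha> ! q = 0" "2 \<le> \<alpha> ! r" "\<alpha> ! s = 1"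
  shows "\<exists>m. 2 \<le> lookup (key_poly \<alpha>) m"
proof -
  let ?v = "\<alpha>[p := \<alpha> ! s, s := \<alpha> ! p]" and ?w = "\<alpha>[q := \<alpha> ! s, s := \<alpha> ! q]"
  let ?m = "Poly_Mapping.nth (move_box (peel ?v) q r)"
    and ?m' = "Poly_Mapping.nth (move_box (peel ?w) p r)"
  have v: "bruhat_le ?v \<alpha>"
    using assms by (intro bruhat_le_swap) auto
  have w: "bruhat_le ?w \<alpha>"
    using assms by (intro bruhat_le_swap) auto
  have "p \<in> support ?v" "p \<notin> support ?w"
    using assms by (auto simp: support_def nth_list_update)
  then have "support ?v \<noteq> support ?w"
    by blast
  moreover have "column_exponent (support ?v) + ?m = column_exponent (support ?w) + ?m'"
    using assms
    by (intro poly_mapping_eqI)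
      (auto simp: lookup_add lookup_column_exponent support_def nth_default_def nth_peel
        move_box_def nth_list_update)
  ultimately have "lookup (key_poly (peel ?v)) ?m + lookup (key_poly (peel ?w)) ?m' \<le>
      lookup (key_poly \<alpha>) (column_exponent (support ?v) + ?m)"
    by (rule two_columns_le_key_poly[OF v w])
  moreover have "1 \<le> lookup (key_poly (peel ?v)) ?m" "1 \<le> lookup (key_poly (peel ?w)) ?m'"
    using assms by (auto intro!: key_poly_move_box simp: nth_peel nth_list_update)
  ultimately show ?thesis
    by (intro exI[of _ "column_exponent (support ?v) + ?m"]) linarith
qed

lemma multiplicity_truncate:
  assumes "\<exists>m. 2 \<le> lookup (key_poly (map (\<lambda>x. x - t) \<alpha>)) m"
  shows "\<exists>m. 2 \<le> lookup (key_poly \<alpha>) m"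
  using assms
proof (induction t)
  case (Suc t)
  have "map (\<lambda>x. x - Suc t) \<alpha> = peel (map (\<lambda>x. x - t) \<alpha>)"
    by (simp add: peel_def)
  with Suc.prems show ?case
    using column_le_key_poly[OF bruhat_le_refl] Suc.IH by (metis order_trans)
qed simp

text \<open>
  Removing columns makes the smallest relevant values 0, which leaves the three configurations
  above.
\<close>

theorem multiplicity_if_not_KM_shape:
  assumes "\<not> KM_shape \<alpha>"
  shows "\<exists>m. 2 \<le> lookup (key_poly \<alpha>) m"
proof -
  from assms consider
    (chain) i j k where "i < j" "j < k" "k < length \<alpha>" "\<alpha> ! i < \<alpha> ! j" "\<alpha> ! j < \<alpha> ! k"
  | (pairs) i j k l where "i < j" "j < k" "k < l" "l < length \<alpha>"
      "max (\<alpha> ! i) (\<alpha> ! j) < min (\<alpha> ! k) (\<alpha> ! l)"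
      "\<not> (\<alpha> ! i = \<alpha> ! j \<and> \<alpha> ! k = Suc (\<alpha> ! j) \<and> \<alpha> ! l = Suc (\<alpha> ! j))"
    unfolding KM_shape_def by blast
  then show ?thesis
  proof cases
    case chain
    show ?thesis
      by (rule multiplicity_truncate[of "\<alpha> ! j - 1"],
          rule multiplicity_012[of i j k]) (use chain in auto)
  next
    case (pairs i j k l)
    consider "\<alpha> ! i < \<alpha> ! j" | "\<alpha> ! k < \<alpha> ! l" | "\<alpha> ! j \<le> \<alpha> ! i" "\<alpha> ! l < \<alpha> ! k"
      | "\<alpha> ! j \<le> \<alpha> ! i" "\<alpha> ! k = \<alpha> ! l"
      by linarith
    then show ?thesis
    proof cases
      case 1
      show ?thesis
        by (rule multiplicity_truncate[of "\<alpha> ! j - 1"],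
            rule multiplicity_012[of i j k]) (use 1 pairs in auto)
    next
      case 2
      show ?thesis
        by (rule multiplicity_truncate[of "\<alpha> ! k - 1"],
            rule multiplicity_012[of j k l]) (use 2 pairs in auto)
    next
      case 3
      show ?thesis
        by (rule multiplicity_truncate[of "\<alpha> ! l - 1"],
            rule multiplicity_0021[of i j k l]) (use 3 pairs in auto)
    next
      case 4
      show ?thesis
        by (rule multiplicity_truncate[of "\<alpha> ! l - 2"],
            rule multiplicity_1022[of i j k l]) (use 4 pairs in auto)
    qed
  qed
qed

lemma not_multiplicity_free:
  assumes "2 \<le> lookup (key_poly \<alpha>) m"
  shows "\<not> multiplicity_free (length \<alpha>) (key_poly \<alpha>)"
proof -
  define \<gamma> where "\<gamma> = map (lookup m) [0..<length \<alpha>]"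
  have "m \<in> keys (key_poly \<alpha>)"
    using assms by (auto simp: in_keys_iff)
  then have "lookup m i = 0" if "length \<alpha> \<le> i" for i
    using keys_key_poly[of m \<alpha> 0 "Max (set \<alpha>)"] that by simp
  then have "Poly_Mapping.nth \<gamma> = m"
    by (intro poly_mapping_eqI) (auto simp: \<gamma>_def nth_default_def)
  then have "coefficient (key_poly \<alpha>) \<gamma> \<notin> {0, 1}"
    using assms by (simp add: coefficient_def)
  then show ?thesis
    unfolding multiplicity_free_def by (metis \<gamma>_def length_map length_upt diff_zero)
qed

section \<open>The pattern conditions\<close>

text \<open>
  The pattern condition for two pairs of a position in \<open>\<alpha>\<close> and the pattern value assigned to it.
  As a binary relation on such pairs it turns pattern containment into a \<open>sorted_wrt\<close> statement,
  which the simplifier unfolds for lists of given length.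
\<close>

definition matches :: "nat list \<Rightarrow> nat \<times> nat \<Rightarrow> nat \<times> nat \<Rightarrow> bool" where
  "matches \<alpha> = (\<lambda>(p, a) (q, b). p < q \<and> q < length \<alpha> \<and>
     (\<alpha> ! p \<le> \<alpha> ! q \<longleftrightarrow> a \<le> b) \<and> (\<alpha> ! q \<le> \<alpha> ! p \<longleftrightarrow> b \<le> a) \<and>
     \<bar>int a - int b\<bar> \<le> \<bar>int (\<alpha> ! p) - int (\<alpha> ! q)\<bar>)"

lemma contains_pattern_iff_matches:
  assumes "2 \<le> length \<beta>"
  shows "contains_pattern \<alpha> \<beta> \<longleftrightarrow>
    (\<exists>ps. length ps = length \<beta> \<and> sorted_wrt (matches \<alpha>) (zip ps \<beta>))"
proof
  assume "contains_pattern \<alpha> \<beta>"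
  then obtain p where p: "strict_mono_on {..<length \<beta>} p" "\<forall>s<length \<beta>. p s < length \<alpha>"
    "\<And>s t. s < length \<beta> \<Longrightarrow> t < length \<beta> \<Longrightarrow> (\<alpha> ! p s \<le> \<alpha> ! p t \<longleftrightarrow> \<beta> ! s \<le> \<beta> ! t) \<and>
       \<bar>int (\<alpha> ! p s) - int (\<alpha> ! p t)\<bar> \<ge> \<bar>int (\<beta> ! s) - int (\<beta> ! t)\<bar>"
    unfolding contains_pattern_def by blast
  have "sorted_wrt (matches \<alpha>) (zip (map p [0..<length \<beta>]) \<beta>)"
    using p by (simp add: sorted_wrt_iff_nth_less matches_def strict_mono_on_def)
  then show "\<exists>ps. length ps = length \<beta> \<and> sorted_wrt (matches \<alpha>) (zip ps \<beta>)"
    by (intro exI[of _ "map p [0..<length \<beta>]"]) simp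
next
  assume "\<exists>ps. length ps = length \<beta> \<and> sorted_wrt (matches \<alpha>) (zip ps \<beta>)"
  then obtain ps where len: "length ps = length \<beta>" and ps: "sorted_wrt (matches \<alpha>) (zip ps \<beta>)"
    by blast
  have less: "matches \<alpha> (ps ! s, \<beta> ! s) (ps ! t, \<beta> ! t)" if "s < t" "t < length \<beta>" for s t
    using sorted_wrt_nth_less[OF ps, of s t] that len by simp
  have "strict_mono_on {..<length \<beta>} ((!) ps)"
    using less by (auto simp: strict_mono_on_def matches_def)
  moreover have "ps ! s < length \<alpha>" if "s < length \<beta>" for s
    using less[of s "length \<beta> - 1"] less[of 0 s] assms that
    by (cases "s = 0") (auto simp: matches_def)
  moreover have "(\<alpha> ! (ps ! s) \<le> \<alpha> ! (ps ! t) \<longleftrightarrow> \<beta> ! s \<le> \<beta> ! t) \<and>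
      \<bar>int (\<alpha> ! (ps ! s)) - int (\<alpha> ! (ps ! t))\<bar> \<ge> \<bar>int (\<beta> ! s) - int (\<beta> ! t)\<bar>"
    if "s < length \<beta>" "t < length \<beta>" for s t
    using less[of s t] less[of t s] that
    by (cases s t rule: linorder_cases) (auto simp: matches_def abs_minus_commute)
  ultimately show "contains_pattern \<alpha> \<beta>"
    unfolding contains_pattern_def by blast
qed

lemma ex_length_Suc: "(\<exists>ps. length ps = Suc n \<and> P ps) \<longleftrightarrow> (\<exists>i ps. length ps = n \<and> P (i # ps))"
  by (auto simp: length_Suc_conv)

lemma contains_pattern3:
  "contains_pattern \<alpha> [a, b, c] \<longleftrightarrow> (\<exists>i j k. sorted_wrt (matches \<alpha>) [(i, a), (j, b), (k, c)])"
  by (subst contains_pattern_iff_matches)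
    (simp_all only: list.size One_nat_def add_0_right add_Suc_right ex_length_Suc length_0_conv simp_thms zip_Cons_Cons zip_Nil)

lemma contains_pattern4:
  "contains_pattern \<alpha> [a, b, c, d] \<longleftrightarrow>
     (\<exists>i j k l. sorted_wrt (matches \<alpha>) [(i, a), (j, b), (k, c), (l, d)])"
  by (subst contains_pattern_iff_matches)
    (simp_all only: list.size One_nat_def add_0_right add_Suc_right ex_length_Suc length_0_conv simp_thms zip_Cons_Cons zip_Nil)

text \<open>
  Two positions followed by two positions with larger entries carry one of the four remaining
  patterns, according to whether the lower and the upper pair of values decrease strictly; only
  the pattern \<open>(0,0,2,2)\<close> imposes a distance that the inequalities do not already give.
\<close>

lemma KM_shape_if_avoids:
  assumes "\<forall>\<beta>\<in>{[0,1,2], [0,0,2,2], [0,0,2,1], [1,0,3,2], [1,0,2,2]}. avoids_pattern \<alpha> \<beta>"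
  shows "KM_shape \<alpha>"
proof -
  have no_chain: "\<not> (\<alpha> ! i < \<alpha> ! j \<and> \<alpha> ! j < \<alpha> ! k)" if "i < j" "j < k" "k < length \<alpha>" for i j k
  proof
    assume "\<alpha> ! i < \<alpha> ! j \<and> \<alpha> ! j < \<alpha> ! k"
    with that have "sorted_wrt (matches \<alpha>) [(i, 0), (j, 1), (k, 2)]"
      by (auto simp: matches_def)
    then have "contains_pattern \<alpha> [0, 1, 2]"
      unfolding contains_pattern3 by blast
    with bspec[OF assms insertI1] show False ..
  qed
  have tight: "\<alpha> ! i = \<alpha> ! j \<and> \<alpha> ! k = Suc (\<alpha> ! j) \<and> \<alpha> ! l = Suc (\<alpha> ! j)"
    if less: "i < j" "j < k" "k < l" "l < length \<alpha>"
      and max: "max (\<alpha> ! i) (\<alpha> ! j) < min (\<alpha> ! k) (\<alpha> ! l)" for i j k l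
  proof (rule ccontr)
    assume not_tight: "\<not> ?thesis"
    have pattern: False if "sorted_wrt (matches \<alpha>) [(i, a), (j, b), (k, c), (l, d)]"
      and "[a, b, c, d] \<in> {[0,0,2,2], [0,0,2,1], [1,0,3,2], [1,0,2,2]}" for a b c d
    proof -
      have "contains_pattern \<alpha> [a, b, c, d]"
        unfolding contains_pattern4 using that(1) by blast
      with bspec[OF assms insertI2[OF that(2)]] show False ..
    qed
    have "\<alpha> ! j \<le> \<alpha> ! i" "\<alpha> ! l \<le> \<alpha> ! k"
      using no_chain[of i j k] no_chain[of j k l] less max by auto
    then consider "\<alpha> ! i = \<alpha> ! j" "\<alpha> ! k = \<alpha> ! l" | "\<alpha> ! i = \<alpha> ! j" "\<alpha> ! l < \<alpha> ! k"
      | "\<alpha> ! j < \<alpha> ! i" "\<alpha> ! l < \<alpha> ! k" | "\<alpha> ! j < \<alpha> ! i" "\<alpha> ! k = \<alpha> ! l"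
      by linarith
    then show False
    proof cases
      case 1
      then show False
        using less max not_tight by (intro pattern[of 0 0 2 2]) (auto simp: matches_def)
    next
      case 2
      then show False
        using less max by (intro pattern[of 0 0 2 1]) (auto simp: matches_def)
    next
      case 3
      then show False
        using less max by (intro pattern[of 1 0 3 2]) (auto simp: matches_def)
    next
      case 4
      then show False
        using less max by (intro pattern[of 1 0 2 2]) (auto simp: matches_def)
    qed
  qed
  show ?thesis
    unfolding KM_shape_def using no_chain tight by blast
qed

lemma KM_shape_avoids:
  assumes "KM_shape \<alpha>" and "\<beta> \<in> {[0,1,2], [0,0,2,2], [0,0,2,1], [1,0,3,2], [1,0,2,2]}"
  shows "avoids_pattern \<alpha> \<beta>"
proof
  assume contains: "contains_pattern \<alpha> \<beta>"
  show False
  proof (cases "\<beta> = [0, 1, 2]")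
    case True
    with contains obtain i j k where "sorted_wrt (matches \<alpha>) [(i, 0), (j, 1), (k, 2)]"
      by (auto simp only: contains_pattern3)
    then have "i < j" "j < k" "k < length \<alpha>" "\<alpha> ! i < \<alpha> ! j" "\<alpha> ! j < \<alpha> ! k"
      by (auto simp: matches_def)
    with KM_shape_no_chain[OF assms(1), of i j k] show False
      by simp
  next
    case False
    with assms(2) have four: "\<beta> \<in> {[0,0,2,2], [0,0,2,1], [1,0,3,2], [1,0,2,2]}"
      by (simp only: insert_iff simp_thms)
    then have "\<exists>a b c d. \<beta> = [a, b, c, d]"
      by auto
    then obtain a b c d where \<beta>: "\<beta> = [a, b, c, d]"
      by blast
    with contains obtain i j k l
      where m: "sorted_wrt (matches \<alpha>) [(i, a), (j, b), (k, c), (l, d)]"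
      by (auto simp only: contains_pattern4)
    have entries: "a < c" "a < d" "b < d" "b + 2 \<le> c"
      using four unfolding \<beta> by auto
    have idx: "i < j" "j < k" "k < l" "l < length \<alpha>"
      using m by (simp_all add: matches_def)
    have less: "\<alpha> ! i < \<alpha> ! k" "\<alpha> ! i < \<alpha> ! l" "\<alpha> ! j < \<alpha> ! l" "\<alpha> ! j < \<alpha> ! k"
      using m entries by (simp_all add: matches_def)
    have "matches \<alpha> (j, b) (k, c)"
      using m by simp
    then have "\<bar>int b - int c\<bar> \<le> \<bar>int (\<alpha> ! j) - int (\<alpha> ! k)\<bar>"
      by (simp only: matches_def prod.case)
    with entries(4) less(4) have "\<alpha> ! j + 2 \<le> \<alpha> ! k"
      by linarith
    have "max (\<alpha> ! i) (\<alpha> ! j) < min (\<alpha> ! k) (\<alpha> ! l)"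
      using less by simp
    with KM_shape_tight(2)[OF assms(1) idx] \<open>\<alpha> ! j + 2 \<le> \<alpha> ! k\<close> show False
      by simp
  qed
qed

theorem theorem1p1:
  fixes n :: nat and \<alpha> :: "nat list"
  assumes "n \<ge> 1" and "length \<alpha> = n"
  shows "multiplicity_free n (key_poly \<alpha>) \<longleftrightarrow> \<alpha> \<in> KM n"
proof -
  have "\<alpha> \<in> KM n \<longleftrightarrow> KM_shape \<alpha>"
    using assms(2) KM_shape_if_avoids[of \<alpha>] KM_shape_avoids[of \<alpha>] by (auto simp only: KM_def mem_Collect_eq)
  moreover have "multiplicity_free n (key_poly \<alpha>)" if "KM_shape \<alpha>"
    using that by (intro mult_free_imp_multiplicity_free mult_free_key_poly)
  moreover have "\<not> multiplicity_free n (key_poly \<alpha>)" if "\<not> KM_shape \<alpha>"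
    using multiplicity_if_not_KM_shape[OF that] not_multiplicity_free[of \<alpha>] assms(2) by auto
  ultimately show ?thesis
    by blast
qed

end
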